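(* Let $\mathbb T$ be a time scale and let $\mathcal A:\mathbb T\to \mathbf M_n(\mathbb R)$ be a bounded, rd-continuous, regressive matrix function. Let $\chi(\mathcal A)$ be the central upper exponent of the linear system $x^\Delta=\mathcal A(t)x$. If $\chi(\mathcal A)<0$, then there exists $\varepsilon>0$ such that for every $r>0$ and every $f:\mathbb T_0^+\times B_r\to\mathbb R^n$ for which there is $r_1\in(0,r]$ with $$|f(t,x)|\le \varepsilon|x|\qquad\text{for all } t\in\mathbb T_0^+,\ x\in B_{r_1},$$ the zero solution of the system $x^\Delta=\mathcal A(t)x+f(t,x)$ is asymptotically stable.
   Context: A time scale $\mathbb T$ is an unbounded closed subset of $\mathbb R$ with $0\in\mathbb T$; $\mathbb T_a^+=[a,\infty)\cap\mathbb T$. Forward jump: $\sigma(t)=\inf\{s\in\mathbb T: s>t\}$; graininess: $\mu(t)=\sigma(t)-t$. $\mathbb S=\{t\in\mathbb T:\sigma(t)>t\}$ is the set of right-scattered points, $\mathbb D=\{t\in\mathbb T:\sigma(t)=t\}$ the set of right-dense points. It is always assumed that $\sup\mathbb S=+\infty$. $B_r$ is the Euclidean ball of radius $r$ centred at $0$ in $\mathbb R^n$, $|\cdot|$ is a vector norm and the corresponding operator norm, $E_n$ is the identity matrix. A function on $\mathbb T$ is rd-continuous if it is continuous at right-dense points and has finite left-sided limits at left-dense points. $f^\Delta(t)=\gamma$ means: for every $\epsilon>0$ there is a neighbourhood $W$ of $t$ with $|f(\sigma(t))-f(s)-\gamma(\sigma(t)-s)|\le\epsilon|\sigma(t)-s|$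 for all $s\in W\cap\mathbb T$. If $F^\Delta=f$, then $\int_\tau^s f(t)\,\Delta t=F(s)-F(\tau)$. A matrix function $\mathcal A$ is regressive if $E_n+\mu(t)\mathcal A(t)$ is invertible for all $t\in\mathbb T$. $\Phi_{\mathcal A}(t,s)$, $t\ge s$, is the fundamental matrix: $\Phi_{\mathcal A}^\Delta(t,s)=\mathcal A(t)\Phi_{\mathcal A}(t,s)$ (derivative in $t$), $\Phi_{\mathcal A}(s,s)=E_n$. Generalized exponential: $e_u(t,s)=\exp\left(\int_s^t\xi_{\mu(\tau)}(u(\tau))\,\Delta\tau\right)$, where $\xi_h(z)=\log(1+zh)/h$ for $h\ne0$ and $\xi_0(z)=z$. An upper function for $x^\Delta=\mathcal A(t)x$ is an rd-continuous function $u:\mathbb T_0^+\to\mathbb R$ (with $1+\mu(t)u(t)>0$, so that $e_u$ is defined and positive) for which there is $C>0$ such that $|\Phi_{\mathcal A}(t,s)|\le C e_u(t,s)$ for all $t,s\in\mathbb T_0^+$, $t\ge s$. The central upper exponent is $$\chi(\mathcal A)=\inf_{u}\ \limsup_{t\to\infty}\frac1t\int_0^t u(\tau)\,\Delta\tau,$$ the infimum being over all upper functions $u$. $x(t,t_0,x_0)$ denotes the solution of the system with $x(t_0)=x_0$; it is implicit that $f$ is regular enough for initial value problems to be uniquely solvable forward in time as long as the solution stays in $B_r$. The zero solution is stable if for every $t_0\in\mathbb T_0^+$ and $\epsilon>0$ there is $\delta>0$ such that $|x_0|<\delta$ implies that $x(t,t_0,x_0)$ exists and $|x(t,t_0,x_0)|<\epsilon$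 for all $t\in\mathbb T_{t_0}^+$. It is asymptotically stable if it is stable and for every $t_0\in\mathbb T_0^+$ there is $c>0$ such that $|x_0|<c$ implies $x(t,t_0,x_0)\to0$ as $t\to+\infty$. *)

theory Defs
  imports "HOL-Analysis.Analysis"
begin

definition time_scale :: "real set \<Rightarrow> bool" where
  "time_scale T \<longleftrightarrow> closed T \<and> \<not> bounded T \<and> 0 \<in> T"

definition ts_from :: "real set \<Rightarrow> real \<Rightarrow> real set" where
  "ts_from T a = T \<inter> {a..}"

text \<open>
  The set \<open>X\<close> in the definitions below is a time scale or one of its rays. \<open>\<sigma>\<close> and \<open>\<mu>\<close> are only
  meaningful if \<open>X\<close> is unbounded above (the infimum is then over a nonempty set); this follows from
  the standing assumption that \<open>right_scattered T\<close> is unbounded above.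
\<close>

definition sigma :: "real set \<Rightarrow> real \<Rightarrow> real" where
  "sigma X t = Inf {s \<in> X. s > t}"

definition mu :: "real set \<Rightarrow> real \<Rightarrow> real" where
  "mu X t = sigma X t - t"

definition right_scattered :: "real set \<Rightarrow> real set" where
  "right_scattered X = {t \<in> X. sigma X t > t}"

definition right_dense :: "real set \<Rightarrow> real set" where
  "right_dense X = {t \<in> X. sigma X t = t}"

definition left_dense :: "real set \<Rightarrow> real set" where
  "left_dense X = {t \<in> X. t islimpt (X \<inter> {..<t})}"

definition rd_continuous :: "real set \<Rightarrow> (real \<Rightarrow> 'a::topological_space) \<Rightarrow> bool" where
  "rd_continuous X f \<longleftrightarrow>
     (\<forall>t\<in>right_dense X. (f \<longlongrightarrow> f t) (at t within X)) \<and>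
     (\<forall>t\<in>left_dense X. \<exists>l. (f \<longlongrightarrow> l) (at t within (X \<inter> {..<t})))"

text \<open>
  \<open>f\<^sup>\<Delta>(t) = \<gamma>\<close> on \<open>X\<close>. At the least point of a ray \<open>X\<close> only points \<open>s\<close> of that ray are tested, which is
  the sense in which initial value problems are posed forward in time.
\<close>

definition has_delta_derivative ::
    "real set \<Rightarrow> (real \<Rightarrow> 'a::real_normed_vector) \<Rightarrow> real \<Rightarrow> 'a \<Rightarrow> bool" where
  "has_delta_derivative X f t \<gamma> \<longleftrightarrow>
     (\<forall>\<epsilon>>0. \<exists>W. open W \<and> t \<in> W \<and>
        (\<forall>s\<in>W \<inter> X. norm (f (sigma X t) - f s - (sigma X t - s) *\<^sub>R \<gamma>) \<le> \<epsilon> * \<bar>sigma X t - s\<bar>))"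

text \<open>
  The value \<open>F b - F a\<close> does not depend on the choice of the antiderivative \<open>F\<close>, and an antiderivative
  exists if \<open>f\<close> is rd-continuous on \<open>X\<close>.
\<close>

definition delta_integral :: "real set \<Rightarrow> (real \<Rightarrow> real) \<Rightarrow> real \<Rightarrow> real \<Rightarrow> real" where
  "delta_integral X f a b =
     (THE I. \<exists>F. (\<forall>t\<in>X. has_delta_derivative X F t (f t)) \<and> I = F b - F a)"

definition xi :: "real \<Rightarrow> real \<Rightarrow> real" where
  "xi h z = (if h = 0 then z else ln (1 + z * h) / h)"

definition gen_exp :: "real set \<Rightarrow> (real \<Rightarrow> real) \<Rightarrow> real \<Rightarrow> real \<Rightarrow> real" where
  "gen_exp X u t s = exp (delta_integral X (\<lambda>\<tau>. xi (mu X \<tau>) (u \<tau>)) s t)"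

definition vector_norm :: "(real ^ 'n \<Rightarrow> real) \<Rightarrow> bool" where
  "vector_norm N \<longleftrightarrow>
     (\<forall>x. 0 \<le> N x) \<and>
     (\<forall>x. N x = 0 \<longleftrightarrow> x = 0) \<and>
     (\<forall>c x. N (c *\<^sub>R x) = \<bar>c\<bar> * N x) \<and>
     (\<forall>x y. N (x + y) \<le> N x + N y)"

definition operator_norm :: "(real ^ 'n \<Rightarrow> real) \<Rightarrow> real ^ 'n ^ 'n \<Rightarrow> real" where
  "operator_norm N M = (SUP x\<in>- {0}. N (M *v x) / N x)"

definition regressive :: "real set \<Rightarrow> (real \<Rightarrow> real ^ 'n ^ 'n) \<Rightarrow> bool" where
  "regressive T A \<longleftrightarrow> (\<forall>t\<in>T. invertible (mat 1 + mu T t *\<^sub>R A t))"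

text \<open>
  For bounded rd-continuous \<open>A\<close> the matrix solution \<open>Y\<close> below exists and is unique on \<open>\<T>\<^sub>s\<^sup>+\<close>.
\<close>

definition fundamental_matrix ::
    "real set \<Rightarrow> (real \<Rightarrow> real ^ 'n ^ 'n) \<Rightarrow> real \<Rightarrow> real \<Rightarrow> real ^ 'n ^ 'n" where
  "fundamental_matrix T A t s =
     (THE M. \<exists>Y. Y s = mat 1 \<and>
        (\<forall>\<tau>\<in>ts_from T s. has_delta_derivative (ts_from T s) Y \<tau> (A \<tau> ** Y \<tau>)) \<and> M = Y t)"

definition upper_function ::
    "(real ^ 'n \<Rightarrow> real) \<Rightarrow> real set \<Rightarrow> (real \<Rightarrow> real ^ 'n ^ 'n) \<Rightarrow> (real \<Rightarrow> real) \<Rightarrow> bool" where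
  "upper_function N T A u \<longleftrightarrow>
     rd_continuous (ts_from T 0) u \<and>
     (\<forall>t\<in>ts_from T 0. 1 + mu T t * u t > 0) \<and>
     (\<exists>C>0. \<forall>t\<in>ts_from T 0. \<forall>s\<in>ts_from T 0. s \<le> t \<longrightarrow>
        operator_norm N (fundamental_matrix T A t s) \<le> C * gen_exp (ts_from T 0) u t s)"

definition central_upper_exponent ::
    "(real ^ 'n \<Rightarrow> real) \<Rightarrow> real set \<Rightarrow> (real \<Rightarrow> real ^ 'n ^ 'n) \<Rightarrow> ereal" where
  "central_upper_exponent N T A =
     (INF u\<in>{u. upper_function N T A u}.
        Limsup (inf at_top (principal T))
          (\<lambda>t. ereal (1 / t * delta_integral (ts_from T 0) u 0 t)))"

text \<open>
  \<open>x\<close> solves the initial value problem \<open>x(t\<^sub>0) = x\<^sub>0\<close> with the equation holding at all times in \<open>J\<close>, an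
  initial segment of \<open>\<T>\<^bsub>t0\<^esub>\<^sup>+\<close>. If \<open>J\<close> has a right-scattered last point \<open>t\<close>, the equation there
  determines \<open>x(\<sigma>(t))\<close>, which may lie outside \<open>B\<^sub>r\<close>.
\<close>

definition delta_solution ::
    "real set \<Rightarrow> real \<Rightarrow> (real \<Rightarrow> real ^ 'n \<Rightarrow> real ^ 'n) \<Rightarrow> real \<Rightarrow> real ^ 'n \<Rightarrow> real set \<Rightarrow>
     (real \<Rightarrow> real ^ 'n) \<Rightarrow> bool" where
  "delta_solution T r g t0 x0 J x \<longleftrightarrow>
     x t0 = x0 \<and>
     (\<forall>t\<in>J. x t \<in> ball 0 r \<and> has_delta_derivative (ts_from T t0) x t (g t (x t)))"

text \<open>
  Unique solvability of initial value problems forward in time as long as the solution stays in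
  \<open>B\<^sub>r\<close>: there is a solution that exists for all times, or up to a time \<open>b\<close> at which it leaves the
  open ball, either by jumping out of it or by coming arbitrarily close to its boundary before \<open>b\<close>.
\<close>

definition uniquely_solvable ::
    "real set \<Rightarrow> real \<Rightarrow> (real \<Rightarrow> real ^ 'n \<Rightarrow> real ^ 'n) \<Rightarrow> bool" where
  "uniquely_solvable T r g \<longleftrightarrow>
     (\<forall>t0\<in>ts_from T 0. \<forall>x0\<in>ball 0 r.
        ((\<exists>x. delta_solution T r g t0 x0 (ts_from T t0) x) \<or>
         (\<exists>b>t0. \<exists>x. delta_solution T r g t0 x0 (T \<inter> {t0..<b}) x \<and>
            ((\<exists>t\<in>T \<inter> {t0..<b}. x (sigma T t) \<notin> ball 0 r) \<or>
             (\<forall>\<rho><r. \<exists>t\<in>T \<inter> {t0..<b}. \<rho> < norm (x t))))) \<and>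
        (\<forall>b x y. delta_solution T r g t0 x0 (T \<inter> {t0..<b}) x \<longrightarrow>
            delta_solution T r g t0 x0 (T \<inter> {t0..<b}) y \<longrightarrow>
            (\<forall>t\<in>T \<inter> {t0..<b}. x t = y t)))"

definition zero_stable ::
    "(real ^ 'n \<Rightarrow> real) \<Rightarrow> real set \<Rightarrow> real \<Rightarrow> (real \<Rightarrow> real ^ 'n \<Rightarrow> real ^ 'n) \<Rightarrow> bool" where
  "zero_stable N T r g \<longleftrightarrow>
     (\<forall>t0\<in>ts_from T 0. \<forall>\<epsilon>>0. \<exists>\<delta>>0. \<forall>x0. N x0 < \<delta> \<longrightarrow>
        (\<exists>x. delta_solution T r g t0 x0 (ts_from T t0) x) \<and>
        (\<forall>x. delta_solution T r g t0 x0 (ts_from T t0) x \<longrightarrow>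
           (\<forall>t\<in>ts_from T t0. N (x t) < \<epsilon>)))"

definition zero_asymptotically_stable ::
    "(real ^ 'n \<Rightarrow> real) \<Rightarrow> real set \<Rightarrow> real \<Rightarrow> (real \<Rightarrow> real ^ 'n \<Rightarrow> real ^ 'n) \<Rightarrow> bool" where
  "zero_asymptotically_stable N T r g \<longleftrightarrow>
     zero_stable N T r g \<and>
     (\<forall>t0\<in>ts_from T 0. \<exists>c>0. \<forall>x0. N x0 < c \<longrightarrow>
        (\<exists>x. delta_solution T r g t0 x0 (ts_from T t0) x) \<and>
        (\<forall>x. delta_solution T r g t0 x0 (ts_from T t0) x \<longrightarrow>
           (x \<longlongrightarrow> 0) (inf at_top (principal T))))"

end

(*
  Let u be an upper function whose mean value has negative upper limit, and C the constant in
  |Phi(t,s)| <= C e_u(t,s). With v(t) = exp (int_0^t (u + C eps + kappa)), one shows by induction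
  along the time scale that a solution x of the perturbed system satisfies
    |Phi(t',t) x(t)| <= K v(t) e_u(t',t)   for all t' >= t.
  The quantity sup_t' |Phi(t',t) x| / e_u(t',t) is a Lyapunov function that is equivalent to |x| and
  is contracted by the linear flow at the rate e_u; a jump of length mu multiplies it by at most
  (1 + mu u) + C eps mu = 1 + mu (u + C eps) <= exp (mu (u + C eps)), whatever the size of mu. The
  margin kappa absorbs the error terms at right-dense points. For t' = t the estimate gives
  |x(t)| <= K v(t), and v tends to 0 once C eps + kappa is small.
*)
theory Submission
  imports Defs
begin

text \<open>Apart from its bound near 0, \<open>f\<close> is only known to give unique solvability,
  so \<open>f t (x t)\<close> need not be delta integrable along a solution. Variation of constants
  with a Gronwall integral inequality is thus not at hand, and the estimate is propagated from the
  pointwise delta derivative of \<open>x\<close>. The supremum over t' is never formed; the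
  quantifier over t' in the induction claim replaces it.

  Two antiderivatives are kept apart: \<open>E\<close>, of the cylinder transform of
  \<open>u\<close>, which gives e_u(t,s) = exp (E t - E s), and \<open>U\<close>, of
  \<open>u\<close> itself, whose mean the central upper exponent measures. From ln (1 + h z) / h <=
  z comes E t - E s <= U t - U s, and only this direction is used.

  The smallness of \<open>f\<close> holds only near 0. A factor K with K v <= q makes the claim
  itself keep the solution in that region, so it can neither jump out of the ball nor approach its
  boundary; this also yields existence for all times.

  The constants come from the linear part alone: with U(t)/t < c < 0 for large t, the choice C eps +
  kappa = -c/2 leaves v(t) <= exp (c t / 2). Hence eps is fixed before \<open>r\<close> and
  \<open>f\<close>.\<close>

section \<open>Calculus on a ray of a time scale\<close>

lemma sigma_ray: "s \<le> t \<Longrightarrow> sigma (X \<inter> {s..}) t = sigma X t"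
  unfolding sigma_def by (rule arg_cong[where f=Inf]) auto

lemma has_delta_derivativeE:
  assumes "has_delta_derivative X F t d" "\<epsilon> > 0"
  obtains W where "open W" "t \<in> W"
    "\<And>s. s \<in> W \<inter> X \<Longrightarrow> norm (F (sigma X t) - F s - (sigma X t - s) *\<^sub>R d) \<le> \<epsilon> * \<bar>sigma X t - s\<bar>"
proof -
  have "\<exists>W. open W \<and> t \<in> W \<and>
      (\<forall>s\<in>W \<inter> X. norm (F (sigma X t) - F s - (sigma X t - s) *\<^sub>R d) \<le> \<epsilon> * \<bar>sigma X t - s\<bar>)"
    using assms unfolding has_delta_derivative_def by simp
  then show thesis by (elim exE conjE) (rule that, auto)
qed

lemma has_delta_derivative_subset:
  assumes "has_delta_derivative X F t d" "X' \<subseteq> X" "sigma X' t = sigma X t"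
  shows "has_delta_derivative X' F t d"
  unfolding has_delta_derivative_def
proof (intro allI impI)
  fix \<epsilon> :: real assume "\<epsilon> > 0"
  then obtain W where "open W" "t \<in> W"
    "\<And>s. s\<in>W \<inter> X \<Longrightarrow> norm (F (sigma X t) - F s - (sigma X t - s) *\<^sub>R d) \<le> \<epsilon> * \<bar>sigma X t - s\<bar>"
    using has_delta_derivativeE[OF assms(1) \<open>\<epsilon> > 0\<close>] by blast
  then show "\<exists>W. open W \<and> t \<in> W \<and> (\<forall>s\<in>W \<inter> X'. norm (F (sigma X' t) - F s - (sigma X' t - s) *\<^sub>R d) \<le> \<epsilon> * \<bar>sigma X' t - s\<bar>)"
    using assms(2,3) by (intro exI[of _ W]) auto
qed

lemma has_delta_derivative_linear:
  assumes "bounded_linear h" "has_delta_derivative X F t d"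
  shows "has_delta_derivative X (\<lambda>t. h (F t)) t (h d)"
proof -
  interpret bounded_linear h by fact
  obtain B where B: "B > 0" "\<And>x. norm (h x) \<le> norm x * B" using pos_bounded by blast
  show ?thesis
    unfolding has_delta_derivative_def
  proof (intro allI impI)
    fix \<epsilon> :: real assume e: "\<epsilon> > 0"
    then have eB: "\<epsilon> / B > 0" using B by simp
    obtain W where W: "open W" "t \<in> W"
      "\<And>s. s\<in>W \<inter> X \<Longrightarrow> norm (F (sigma X t) - F s - (sigma X t - s) *\<^sub>R d) \<le> \<epsilon> / B * \<bar>sigma X t - s\<bar>"
      using has_delta_derivativeE[OF assms(2) eB] by blast
    have "norm (h (F (sigma X t)) - h (F s) - (sigma X t - s) *\<^sub>R h d) \<le> \<epsilon> * \<bar>sigma X t - s\<bar>"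
      if "s \<in> W \<inter> X" for s
    proof -
      have "norm (h (F (sigma X t) - F s - (sigma X t - s) *\<^sub>R d)) \<le> \<epsilon> / B * \<bar>sigma X t - s\<bar> * B"
        using B(2) mult_right_mono[OF W(3)[OF that]] B(1) by (meson less_imp_le order_trans)
      then show ?thesis using B(1) by (simp add: diff scaleR)
    qed
    then show "\<exists>W. open W \<and> t \<in> W \<and> (\<forall>s\<in>W \<inter> X. norm (h (F (sigma X t)) - h (F s) - (sigma X t - s) *\<^sub>R h d) \<le> \<epsilon> * \<bar>sigma X t - s\<bar>)"
      using W(1,2) by blast
  qed
qed

lemma has_delta_derivative_diff:
  assumes "has_delta_derivative X F t d" "has_delta_derivative X G t e"
  shows "has_delta_derivative X (\<lambda>t. F t - G t) t (d - e)"
  unfolding has_delta_derivative_def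
proof (intro allI impI)
  fix \<epsilon> :: real assume e: "\<epsilon> > 0"
  then have e2: "\<epsilon> / 2 > 0" by simp
  obtain V where V: "open V" "t \<in> V"
      "\<And>s. s\<in>V \<inter> X \<Longrightarrow> norm (F (sigma X t) - F s - (sigma X t - s) *\<^sub>R d) \<le> \<epsilon> / 2 * \<bar>sigma X t - s\<bar>"
    using has_delta_derivativeE[OF assms(1) e2] by blast
  obtain W where W: "open W" "t \<in> W"
      "\<And>s. s\<in>W \<inter> X \<Longrightarrow> norm (G (sigma X t) - G s - (sigma X t - s) *\<^sub>R e) \<le> \<epsilon> / 2 * \<bar>sigma X t - s\<bar>"
    using has_delta_derivativeE[OF assms(2) e2] by blast
  have "norm ((F (sigma X t) - G (sigma X t)) - (F s - G s) - (sigma X t - s) *\<^sub>R (d - e)) \<le> \<epsilon> * \<bar>sigma X t - s\<bar>"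
    if "s \<in> (V \<inter> W) \<inter> X" for s
  proof -
    have eq: "(F (sigma X t) - G (sigma X t)) - (F s - G s) - (sigma X t - s) *\<^sub>R (d - e)
       = (F (sigma X t) - F s - (sigma X t - s) *\<^sub>R d) - (G (sigma X t) - G s - (sigma X t - s) *\<^sub>R e)"
      by (simp add: algebra_simps)
    have "norm (F (sigma X t) - F s - (sigma X t - s) *\<^sub>R d) \<le> \<epsilon> / 2 * \<bar>sigma X t - s\<bar>"
      "norm (G (sigma X t) - G s - (sigma X t - s) *\<^sub>R e) \<le> \<epsilon> / 2 * \<bar>sigma X t - s\<bar>"
      using V(3)[of s] W(3)[of s] that by simp_all
    then show ?thesis
      unfolding eq by (intro order_trans[OF norm_triangle_ineq4]) simp
  qed
  then show "\<exists>W. open W \<and> t \<in> W \<and> (\<forall>s\<in>W \<inter> X. norm ((F (sigma X t) - G (sigma X t)) - (F s - G s) - (sigma X t - s) *\<^sub>R (d - e)) \<le> \<epsilon> * \<bar>sigma X t - s\<bar>)"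
    using V(1,2) W(1,2) by (intro exI[of _ "V \<inter> W"]) auto
qed

lemma has_delta_derivative_const: "has_delta_derivative X (\<lambda>t. c) t 0"
  unfolding has_delta_derivative_def by (auto intro: exI[of _ UNIV])

text \<open>All initial value problems run forward, so the calculus lives on a ray. The least point
  anchors the induction and the antiderivatives; unboundedness above keeps the infimum in
  \<open>sigma\<close> from ranging over the empty set.\<close>

locale ts_ray =
  fixes X :: "real set" and a :: real
  assumes closed_ray: "closed X" and start_in: "a \<in> X"
    and start_le: "\<And>t. t \<in> X \<Longrightarrow> a \<le> t" and unbdd: "\<not> bdd_above X"
begin

lemma exists_greater: "\<exists>s\<in>X. t < s"
  using unbdd unfolding bdd_above_def by (meson not_le)

lemma sigma_props:
  shows sigma_in: "sigma X t \<in> X" and sigma_ge: "t \<le> sigma X t"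
    and sigma_le: "\<And>s. s \<in> X \<Longrightarrow> t < s \<Longrightarrow> sigma X t \<le> s"
proof -
  let ?S = "{s \<in> X. s > t}"
  have ne: "?S \<noteq> {}" using exists_greater by blast
  have bb: "bdd_below ?S" by (rule bdd_belowI[of _ t]) auto
  show "t \<le> sigma X t" unfolding sigma_def using ne by (intro cInf_greatest) auto
  show "\<And>s. s \<in> X \<Longrightarrow> t < s \<Longrightarrow> sigma X t \<le> s" unfolding sigma_def using bb by (intro cInf_lower) auto
  have "Inf ?S \<in> closure ?S" using closure_contains_Inf[OF ne bb] .
  also have "closure ?S \<subseteq> X" using closed_ray by (intro closure_minimal) auto
  finally show "sigma X t \<in> X" unfolding sigma_def .
qed

text \<open>The point s = t is itself an admissible test point, so the error over the gap is below
  every positive bound and must vanish.\<close>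

lemma delta_derivative_scattered:
  assumes "t \<in> X" "has_delta_derivative X F t d"
  shows "F (sigma X t) = F t + (sigma X t - t) *\<^sub>R d"
proof (cases "sigma X t = t")
  case False
  then have p: "sigma X t - t > 0" using sigma_ge[of t] by simp
  have "norm (F (sigma X t) - F t - (sigma X t - t) *\<^sub>R d) \<le> 0 + e" if "e > 0" for e
  proof -
    have "e / (sigma X t - t) > 0" using that p by simp
    then obtain W where W: "t \<in> W" "\<And>s. s\<in>W \<inter> X \<Longrightarrow>
        norm (F (sigma X t) - F s - (sigma X t - s) *\<^sub>R d) \<le> e / (sigma X t - t) * \<bar>sigma X t - s\<bar>"
      using has_delta_derivativeE[OF assms(2)] by blast
    then show ?thesis using W(2)[of t] assms(1) p by simp
  qed
  then have "norm (F (sigma X t) - F t - (sigma X t - t) *\<^sub>R d) \<le> 0" by (rule field_le_epsilon)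
  then show ?thesis by (simp add: algebra_simps)
qed simp

lemma delta_derivative_dense:
  assumes "has_delta_derivative X F t d" "sigma X t = t" "e > 0"
  obtains \<delta> where "\<delta> > 0" "\<And>s. s \<in> X \<Longrightarrow> \<bar>s - t\<bar> < \<delta> \<Longrightarrow> norm (F s - F t - (s - t) *\<^sub>R d) \<le> e * \<bar>s - t\<bar>"
proof -
  obtain W where W: "open W" "t \<in> W"
    "\<And>s. s\<in>W \<inter> X \<Longrightarrow> norm (F (sigma X t) - F s - (sigma X t - s) *\<^sub>R d) \<le> e * \<bar>sigma X t - s\<bar>"
    using has_delta_derivativeE[OF assms(1,3)] by blast
  obtain \<delta> where d: "\<delta> > 0" "ball t \<delta> \<subseteq> W" using W(1,2) open_contains_ball by blast
  have "norm (F s - F t - (s - t) *\<^sub>R d) \<le> e * \<bar>s - t\<bar>" if "s \<in> X" "\<bar>s - t\<bar> < \<delta>" for s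
  proof -
    have "s \<in> W" using that(2) d(2) by (auto simp: dist_real_def abs_minus_commute)
    then have "norm (F t - F s - (t - s) *\<^sub>R d) \<le> e * \<bar>t - s\<bar>" using W(3)[of s] that assms(2) by simp
    moreover have "F s - F t - (s - t) *\<^sub>R d = - (F t - F s - (t - s) *\<^sub>R d)" by (simp add: algebra_simps)
    ultimately show ?thesis by (metis norm_minus_cancel abs_minus_commute)
  qed
  then show thesis using d(1) that by blast
qed

lemma delta_derivative_continuous:
  assumes "t \<in> X" "has_delta_derivative X F t d"
  shows "(F \<longlongrightarrow> F t) (at t within X)"
proof -
  let ?m = "sigma X t - t"
  have m: "?m \<ge> 0" using sigma_ge[of t] by simp
  \<comment> \<open>By \<open>delta_derivative_scattered\<close> the deviation of this function from
    \<open>F t\<close> is, up to sign, the error term in the definition of the derivative. Within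
    distance 1 of t the factor \<open>\<bar>sigma X t - s\<bar>\<close> is at most
    \<open>?m + 1\<close>, which explains \<open>e'\<close> below.\<close>
  have "((\<lambda>s. F s - (s - t) *\<^sub>R d) \<longlongrightarrow> F t) (at t within X)"
  proof (rule tendstoI)
    fix \<epsilon> :: real assume e: "\<epsilon> > 0"
    define e' where "e' = \<epsilon> / (2 * (?m + 1))"
    have e': "e' > 0" using e m by (simp add: e'_def)
    obtain W where W: "open W" "t \<in> W"
      "\<And>s. s\<in>W \<inter> X \<Longrightarrow> norm (F (sigma X t) - F s - (sigma X t - s) *\<^sub>R d) \<le> e' * \<bar>sigma X t - s\<bar>"
      using has_delta_derivativeE[OF assms(2) e'] by blast
    have "\<forall>\<^sub>F s in at t within X. s \<in> W \<inter> ball t 1 \<and> s \<in> X"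
      unfolding eventually_at_topological using W(1,2)
      by (intro exI[of _ "W \<inter> ball t 1"]) (auto)
    then show "\<forall>\<^sub>F s in at t within X. dist (F s - (s - t) *\<^sub>R d) (F t) < \<epsilon>"
    proof eventually_elim
      case (elim s)
      have eq: "F s - (s - t) *\<^sub>R d - F t = - (F (sigma X t) - F s - (sigma X t - s) *\<^sub>R d)"
        using delta_derivative_scattered[OF assms] by (simp add: algebra_simps)
      have "dist (F s - (s - t) *\<^sub>R d) (F t) \<le> e' * \<bar>sigma X t - s\<bar>"
        unfolding dist_norm eq norm_minus_cancel using W(3)[of s] elim by blast
      also have "\<bar>sigma X t - s\<bar> \<le> ?m + 1" using elim m by (auto simp: dist_real_def)
      then have "e' * \<bar>sigma X t - s\<bar> \<le> e' * (?m + 1)" using e' by simp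
      also have "\<dots> = \<epsilon> / 2" using m by (simp add: e'_def field_simps)
      also have "\<dots> < \<epsilon>" using e by simp
      finally show ?case .
    qed
  qed
  moreover have "((\<lambda>s. (s - t) *\<^sub>R d) \<longlongrightarrow> (t - t) *\<^sub>R d) (at t within X)" by (intro tendsto_intros)
  ultimately have "((\<lambda>s. (F s - (s - t) *\<^sub>R d) + (s - t) *\<^sub>R d) \<longlongrightarrow> F t + (t - t) *\<^sub>R d) (at t within X)"
    by (rule tendsto_add)
  then show ?thesis by simp
qed

text \<open>The predecessor is the supremum of the points before t: it lies in the closed set X, and
  it cannot be t, since t would then be a limit point from the left.\<close>

lemma left_gap:
  assumes "t \<in> X" "a < t" "\<not> t islimpt (X \<inter> {..<t})"
  obtains p where "p \<in> X" "p < t" "sigma X p = t"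
proof -
  let ?S = "X \<inter> {..<t}"
  have ne: "?S \<noteq> {}" using start_in assms(2) by auto
  have bd: "bdd_above ?S" by (rule bdd_aboveI[of _ t]) auto
  have "Sup ?S \<in> closure ?S" by (rule closure_contains_Sup[OF ne bd])
  then have c: "Sup ?S \<in> ?S \<or> Sup ?S islimpt ?S" by (auto simp: closure_def)
  have "Sup ?S \<in> X" using \<open>Sup ?S \<in> closure ?S\<close> closure_minimal[of ?S X] closed_ray by auto
  moreover have "Sup ?S \<le> t" using ne by (intro cSup_least) auto
  moreover have "Sup ?S \<noteq> t" using c assms(3) by auto
  ultimately have p: "Sup ?S \<in> X" "Sup ?S < t" by auto
  have "sigma X (Sup ?S) = t"
  proof (rule antisym)
    show "sigma X (Sup ?S) \<le> t" using sigma_le assms(1) p by blast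
    show "t \<le> sigma X (Sup ?S)"
      unfolding sigma_def
    proof (rule cInf_greatest)
      show "{s \<in> X. Sup ?S < s} \<noteq> {}" using p assms(1) by blast
      show "t \<le> s" if "s \<in> {s \<in> X. Sup ?S < s}" for s
      proof (rule ccontr)
        assume "\<not> t \<le> s"
        then have "s \<le> Sup ?S" using that bd by (intro cSup_upper) auto
        then show False using that by simp
      qed
    qed
  qed
  then show thesis using that p by blast
qed

text \<open>Consider the infimum m of the counterexamples. If \<open>P m\<close> holds, the
  scattered or the dense step pushes all counterexamples away from m. Otherwise m > a, and m is
  either left-dense or the successor of a point where P holds. \<open>J\<close> is the initial
  segment on which the step hypotheses are available, so that solutions defined only for a while are
  covered.\<close>

lemma ts_induct:
  assumes J: "J \<subseteq> X" "\<And>s t. t \<in> J \<Longrightarrow> s \<in> X \<Longrightarrow> s \<le> t \<Longrightarrow> s \<in> J"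
    and start: "P a"
    and scattered: "\<And>t. t \<in> J \<Longrightarrow> t < sigma X t \<Longrightarrow> P t \<Longrightarrow> P (sigma X t)"
    and dense: "\<And>t. t \<in> J \<Longrightarrow> sigma X t = t \<Longrightarrow> P t \<Longrightarrow> \<exists>\<delta>>0. \<forall>s\<in>X. t < s \<longrightarrow> s < t + \<delta> \<longrightarrow> P s"
    and left: "\<And>t. t \<in> J \<Longrightarrow> t islimpt (X \<inter> {..<t}) \<Longrightarrow> (\<And>s. s \<in> X \<Longrightarrow> s < t \<Longrightarrow> P s) \<Longrightarrow> P t"
    and "t \<in> J"
  shows "P t"
proof (rule ccontr)
  assume nP: "\<not> P t"
  let ?S = "{s \<in> X. \<not> P s}"
  define m where "m = Inf ?S"
  have tS: "t \<in> ?S" using nP assms(7) J by auto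
  have bb: "bdd_below ?S" using start_le by (intro bdd_belowI[of _ a]) auto
  have ne: "?S \<noteq> {}" using tS by blast
  have "m \<in> closure ?S" unfolding m_def by (rule closure_contains_Inf[OF ne bb])
  then have mX: "m \<in> X" using closure_minimal[of ?S X] closed_ray by auto
  have mt: "m \<le> t" unfolding m_def using cInf_lower[OF tS bb] .
  have mJ: "m \<in> J" using J mX mt assms(7) by blast
  have below: "P s" if "s \<in> X" "s < m" for s
    using that cInf_lower[of s ?S] bb unfolding m_def by force
  have greater: "m \<ge> z" if "\<And>s. s \<in> X \<Longrightarrow> \<not> P s \<Longrightarrow> z \<le> s" for z
    unfolding m_def using that by (intro cInf_greatest[OF ne]) auto
  show False
  proof (cases "P m")
    case True
    have gt: "m < s" if "s \<in> X" "\<not> P s" for s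
      using that below[of s] True by (metis linorder_neqE_linordered_idom)
    show False
    proof (cases "m < sigma X m")
      case sc: True
      then have "P (sigma X m)" using scattered mJ True by blast
      then have "m \<ge> sigma X m" using greater gt sigma_le by blast
      then show False using sc by simp
    next
      case False
      then have "sigma X m = m" using sigma_ge[of m] by simp
      then obtain \<delta> where "\<delta> > 0" "\<forall>s\<in>X. m < s \<longrightarrow> s < m + \<delta> \<longrightarrow> P s" using dense mJ True by blast
      then have "m \<ge> m + \<delta>" using gt by (intro greater) force
      then show False using \<open>\<delta> > 0\<close> by simp
    qed
  next
    case False
    then have "m \<noteq> a" using start by auto
    then have "a < m" using start_le[OF mX] by simp
    have "P m"
    proof (cases "m islimpt (X \<inter> {..<m})")
      case True
      then show ?thesis using left mJ below by blast
    next
      case False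
      then obtain p where p: "p \<in> X" "p < m" "sigma X p = m" using left_gap mX \<open>a < m\<close> by blast
      then show ?thesis using scattered[of p] below J(2)[OF mJ, of p] by auto
    qed
    then show False using False by blast
  qed
qed

text \<open>A Gronwall inequality that asks for no integrability of \<open>F'\<close>. The majorant
  grows at a rate exceeding c by \<eta>, and this surplus absorbs the error of the derivative at
  right-dense points; afterwards \<eta> tends to 0.\<close>

lemma delta_growth:
  fixes F :: "real \<Rightarrow> 'b::real_normed_vector"
  assumes J: "J \<subseteq> X" "\<And>s t. t \<in> J \<Longrightarrow> s \<in> X \<Longrightarrow> s \<le> t \<Longrightarrow> s \<in> J"
    and der: "\<And>t. t \<in> J \<Longrightarrow> has_delta_derivative X F t (F' t)"
    and bd: "\<And>t. t \<in> J \<Longrightarrow> norm (F' t) \<le> M * norm (F t) + c"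
    and M: "M \<ge> 0" and c: "c \<ge> 0" and tJ: "t \<in> J"
  shows "norm (F t) \<le> (norm (F a) + c * (t - a)) * exp (M * (t - a))"
proof -
  have *: "norm (F t) \<le> (norm (F a) + (c + \<eta>) * (t - a)) * exp (M * (t - a))" if eta: "\<eta> > 0" for \<eta>
  proof -
    define q where "q = c + \<eta>"
    have q: "q > 0" using c that by (simp add: q_def)
    define R where "R = (\<lambda>t. (norm (F a) + q * (t - a)) * exp (M * (t - a)))"
    \<comment> \<open>Because exp z >= 1 + z, the majorant gains at least as much as one linear step
      of any length, so long gaps need no separate treatment.\<close>
    have R: "R t * (1 + M * (s - t)) + q * (s - t) \<le> R s" if "a \<le> t" "t \<le> s" for s t
    proof -
      have e1: "exp (M * (s - a)) = exp (M * (t - a)) * exp (M * (s - t))"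
        by (simp flip: exp_add add: algebra_simps)
      have "R s = R t * exp (M * (s - t)) + q * (s - t) * exp (M * (s - a))"
        unfolding R_def e1 by (simp add: algebra_simps)
      moreover have "R t * (1 + M * (s - t)) \<le> R t * exp (M * (s - t))"
        using q that by (intro mult_left_mono) (auto simp: R_def)
      moreover have "q * (s - t) * 1 \<le> q * (s - t) * exp (M * (s - a))"
        using q that M by (intro mult_left_mono) auto
      ultimately show ?thesis by linarith
    qed
    have contR: "(R \<longlongrightarrow> R t) (at t within S)" for t S
      unfolding R_def by (intro tendsto_intros)
    have "norm (F t) \<le> R t"
    proof (rule ts_induct[where J = J and P = "\<lambda>t. norm (F t) \<le> R t", OF J _ _ _ _ tJ])
      show "norm (F a) \<le> R a" by (simp add: R_def)
    next
      fix t assume t: "t \<in> J" "t < sigma X t" "norm (F t) \<le> R t"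
      let ?h = "sigma X t - t"
      have tX: "t \<in> X" using t J by auto
      have "norm (F (sigma X t)) \<le> norm (F t) + ?h * norm (F' t)"
        using delta_derivative_scattered[OF tX der[OF t(1)]] norm_triangle_ineq[of "F t" "?h *\<^sub>R F' t"] t(2) by simp
      also have "\<dots> \<le> norm (F t) + ?h * (M * norm (F t) + c)"
        using bd[OF t(1)] t(2) by (intro add_left_mono mult_left_mono) auto
      also have "\<dots> \<le> norm (F t) * (1 + M * ?h) + q * ?h"
        using that t(2) by (simp add: algebra_simps q_def)
      also have "\<dots> \<le> R t * (1 + M * ?h) + q * ?h"
        using t M by (intro add_right_mono mult_right_mono) auto
      also have "\<dots> \<le> R (sigma X t)" using R start_le[OF tX] t(2) by simp
      finally show "norm (F (sigma X t)) \<le> R (sigma X t)" .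
    next
      fix t assume t: "t \<in> J" "sigma X t = t" "norm (F t) \<le> R t"
      have tX: "t \<in> X" using t J by auto
      obtain \<delta> where d: "\<delta> > 0" "\<And>s. s \<in> X \<Longrightarrow> \<bar>s - t\<bar> < \<delta> \<Longrightarrow> norm (F s - F t - (s - t) *\<^sub>R F' t) \<le> \<eta> * \<bar>s - t\<bar>"
        using delta_derivative_dense[OF der[OF t(1)] t(2) eta] by blast
      have "norm (F s) \<le> R s" if s: "s \<in> X" "t < s" "s < t + \<delta>" for s
      proof -
        let ?h = "s - t"
        have "F s = (F s - F t - (s - t) *\<^sub>R F' t) + (F t + ?h *\<^sub>R F' t)" by simp
        then have "norm (F s) \<le> norm (F s - F t - (s - t) *\<^sub>R F' t) + norm (F t + ?h *\<^sub>R F' t)"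
          by (metis norm_triangle_ineq)
        also have "\<dots> \<le> \<eta> * ?h + norm (F t + ?h *\<^sub>R F' t)" using d(2)[of s] s by simp
        also have "\<dots> \<le> \<eta> * ?h + (norm (F t) + ?h * norm (F' t))"
          using norm_triangle_ineq[of "F t" "?h *\<^sub>R F' t"] s by simp
        also have "\<dots> \<le> \<eta> * ?h + (norm (F t) + ?h * (M * norm (F t) + c))"
          using bd[OF t(1)] s by (intro add_left_mono mult_left_mono) auto
        also have "\<dots> = norm (F t) * (1 + M * ?h) + q * ?h" by (simp add: algebra_simps q_def)
        also have "\<dots> \<le> R t * (1 + M * ?h) + q * ?h"
          using t M s by (intro add_right_mono mult_right_mono) auto
        also have "\<dots> \<le> R s" using R start_le[OF tX] s by simp
        finally show ?thesis .
      qed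
      then show "\<exists>\<delta>>0. \<forall>s\<in>X. t < s \<longrightarrow> s < t + \<delta> \<longrightarrow> norm (F s) \<le> R s" using d(1) by blast
    next
      fix t assume t: "t \<in> J" "t islimpt (X \<inter> {..<t})" "\<And>s. s \<in> X \<Longrightarrow> s < t \<Longrightarrow> norm (F s) \<le> R s"
      have tX: "t \<in> X" using t J by auto
      have "(F \<longlongrightarrow> F t) (at t within (X \<inter> {..<t}))"
        using delta_derivative_continuous[OF tX der[OF t(1)]] by (rule tendsto_within_subset) auto
      then show "norm (F t) \<le> R t"
        using t by (intro tendsto_le[OF _ contR tendsto_norm]) (auto simp: trivial_limit_within eventually_at_filter)
    qed
    then show ?thesis by (simp add: R_def q_def)
  qed
  have "a \<le> t" using tJ J start_le by auto
  show ?thesis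
  proof (rule field_le_epsilon)
    fix e :: real assume e: "e > 0"
    \<comment> \<open>Chosen so that the surplus contributed by \<eta> is at most e; the added 1
      avoids a division by zero at t = a.\<close>
    define \<eta> where "\<eta> = e / ((t - a + 1) * exp (M * (t - a)))"
    have "\<eta> > 0" using e \<open>a \<le> t\<close> by (simp add: \<eta>_def)
    have "\<eta> * (t - a) * exp (M * (t - a)) \<le> \<eta> * (t - a + 1) * exp (M * (t - a))"
      using \<open>\<eta> > 0\<close> by (intro mult_right_mono mult_left_mono) auto
    also have "\<dots> = e"
    proof -
      have "(t - a + 1) * exp (M * (t - a)) \<noteq> 0" using \<open>a \<le> t\<close> by auto
      then have "\<eta> * ((t - a + 1) * exp (M * (t - a))) = e" using \<eta>_def nonzero_eq_divide_eq by blast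
      then show ?thesis by (simp only: mult.assoc)
    qed
    finally show "norm (F t) \<le> (norm (F a) + c * (t - a)) * exp (M * (t - a)) + e"
      using *[OF \<open>\<eta> > 0\<close>] by (simp add: algebra_simps)
  qed
qed

lemma zero_delta_derivative_const:
  assumes "\<And>t. t \<in> X \<Longrightarrow> has_delta_derivative X F t 0" "t \<in> X"
  shows "F t = F a"
proof -
  have "norm (F t - F a) \<le> (norm (F a - F a) + 0 * (t - a)) * exp (0 * (t - a))"
    using has_delta_derivative_diff[OF assms(1) has_delta_derivative_const, of _ "F a"] assms(2)
    by (intro delta_growth[where J = X and F' = "\<lambda>_. 0"]) auto
  then show ?thesis by simp
qed

end

section \<open>Integration\<close>

text \<open>A function with one-sided limits is a uniform limit of integrable functions. Having an
  integrable function within e is inherited when adjacent intervals are joined, and near each point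
  a step function with the two one-sided limits as values serves; Bolzano's bisection principle then
  gives the whole interval.\<close>

lemma regulated_integrable:
  fixes f :: "real \<Rightarrow> 'b::banach"
  assumes left: "\<And>x. \<exists>l. (f \<longlongrightarrow> l) (at_left x)" and right: "\<And>x. \<exists>l. (f \<longlongrightarrow> l) (at_right x)"
  shows "f integrable_on {c..d}"
proof (cases "c \<le> d")
  case cd: True
  have "\<exists>g. (\<forall>x\<in>{c..d}. norm (f x - g x) \<le> e) \<and> g integrable_on {c..d}" if e: "e > 0" for e
    using cd
  proof (induction rule: Bolzano)
    case (trans p q r)
    then obtain g1 g2 where g: "\<forall>x\<in>{p..q}. norm (f x - g1 x) \<le> e" "g1 integrable_on {p..q}"
      "\<forall>x\<in>{q..r}. norm (f x - g2 x) \<le> e" "g2 integrable_on {q..r}" by blast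
    let ?g = "\<lambda>x. if x \<le> q then g1 x else g2 x"
    have "?g integrable_on {p..q}"
      by (rule integrable_spike_finite[OF finite.emptyI _ g(2)]) auto
    moreover have "?g integrable_on {q..r}"
      by (rule integrable_spike_finite[OF _ _ g(4), of "{q}"]) auto
    ultimately have "?g integrable_on {p..r}" by (rule Henstock_Kurzweil_Integration.integrable_combine[OF trans(3,4)])
    then show ?case using g by (intro exI[of _ ?g]) auto
  next
    case (local x)
    obtain l where l: "(f \<longlongrightarrow> l) (at_left x)" using left by blast
    obtain r where r: "(f \<longlongrightarrow> r) (at_right x)" using right by blast
    have "\<forall>\<^sub>F y in at_left x. dist (f y) l < e" "\<forall>\<^sub>F y in at_right x. dist (f y) r < e"
      using tendstoD[OF l e] tendstoD[OF r e] by auto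
    then obtain p q where p: "p < x" "\<And>y. p < y \<Longrightarrow> y < x \<Longrightarrow> dist (f y) l < e"
      and q: "x < q" "\<And>y. x < y \<Longrightarrow> y < q \<Longrightarrow> dist (f y) r < e"
      unfolding eventually_at_left_field eventually_at_right_field by blast
    let ?g = "\<lambda>y. if y < x then l else if y = x then f x else r"
    have "\<exists>g. (\<forall>y\<in>{a..b}. norm (f y - g y) \<le> e) \<and> g integrable_on {a..b}"
      if ab: "a \<le> x" "x \<le> b" "b - a < min (x - p) (q - x)" for a b
    proof (intro exI[of _ ?g] conjI ballI)
      fix y assume y: "y \<in> {a..b}"
      have "p < y" "y < q" using y ab by auto
      then show "norm (f y - ?g y) \<le> e"
        using p(2)[of y] q(2)[of y] e by (auto simp: dist_norm intro: less_imp_le)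
    next
      have "?g integrable_on {a..x}"
        by (rule integrable_spike_finite[of "{x}" _ _ "\<lambda>_. l"]) auto
      moreover have "?g integrable_on {x..b}"
        by (rule integrable_spike_finite[of "{x}" _ _ "\<lambda>_. r"]) auto
      ultimately show "?g integrable_on {a..b}" by (rule Henstock_Kurzweil_Integration.integrable_combine[OF ab(1,2)])
    qed
    then show ?case using p(1) q(1) by (intro exI[of _ "min (x - p) (q - x)"]) auto
  qed
  then have "f integrable_on cbox c d" by (intro integrable_uniform_limit) (simp add: cbox_interval)
  then show ?thesis by (simp add: cbox_interval)
qed auto

context ts_ray
begin

text \<open>
  Composing with \<open>rho\<close> extends a function from the ray to the real line, constantly over the gaps;
  the ordinary integral of the extension is the delta integral. The maximum with \<open>a\<close> avoids the
  supremum of an empty set.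
\<close>

definition rho :: "real \<Rightarrow> real" where
  "rho \<theta> = Sup {t \<in> X. t \<le> max a \<theta>}"

lemma rho_props:
  shows rho_in: "rho \<theta> \<in> X" and rho_le_max: "rho \<theta> \<le> max a \<theta>"
    and rho_upper: "\<And>t. t \<in> X \<Longrightarrow> t \<le> \<theta> \<Longrightarrow> t \<le> rho \<theta>"
proof -
  let ?S = "{t \<in> X. t \<le> max a \<theta>}"
  have ne: "?S \<noteq> {}" using start_in by auto
  have bd: "bdd_above ?S" by (rule bdd_aboveI[of _ "max a \<theta>"]) auto
  show "rho \<theta> \<le> max a \<theta>" unfolding rho_def by (rule cSup_least[OF ne]) simp
  show "\<And>t. t \<in> X \<Longrightarrow> t \<le> \<theta> \<Longrightarrow> t \<le> rho \<theta>" unfolding rho_def by (rule cSup_upper[OF _ bd]) simp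
  have "Sup ?S \<in> closure ?S" by (rule closure_contains_Sup[OF ne bd])
  also have "closure ?S \<subseteq> X" using closed_ray by (intro closure_minimal) auto
  finally show "rho \<theta> \<in> X" unfolding rho_def .
qed

lemma rho_ge: "a \<le> rho \<theta>"
  by (rule start_le[OF rho_in])

lemma rho_le: "a \<le> \<theta> \<Longrightarrow> rho \<theta> \<le> \<theta>"
  using rho_le_max[of \<theta>] by simp

lemma rho_eq: "p \<in> X \<Longrightarrow> p \<le> \<theta> \<Longrightarrow> \<theta> < sigma X p \<Longrightarrow> rho \<theta> = p"
  by (metis antisym linorder_not_less order_trans rho_in rho_le rho_upper sigma_le start_le)

lemma rho_start: "\<theta> \<le> a \<Longrightarrow> rho \<theta> = a"
  using rho_le_max[of \<theta>] rho_ge[of \<theta>] by simp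

lemma right_dense_near:
  assumes "sigma X t = t" "t < y"
  shows "\<exists>s\<in>X. t < s \<and> s < y"
proof (rule ccontr)
  assume "\<not> ?thesis"
  then have "y \<le> sigma X t" unfolding sigma_def
    using exists_greater[of t] by (intro cInf_greatest) (auto simp: not_less)
  then show False using assms by simp
qed

lemma rho_gap:
  assumes "rho x < x"
  shows "x \<le> sigma X (rho x)"
proof -
  have "{s \<in> X. s > rho x} = {s \<in> X. s > x}"
    using rho_upper[of _ x] assms by fastforce
  then have "sigma X (rho x) = sigma X x" unfolding sigma_def by simp
  then show ?thesis using sigma_ge[of x] by simp
qed

text \<open>Either \<open>rho\<close> is constant just to the left of x (before the ray, inside a
  gap, or at a point with a predecessor), or x is left-dense; then \<open>rho\<close> approaches x
  through earlier points of X and the left limit of g carries over.\<close>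

lemma rd_continuous_left_limit:
  fixes g :: "real \<Rightarrow> 'b::topological_space"
  assumes "rd_continuous X g"
  shows "\<exists>l. ((\<lambda>\<theta>. g (rho \<theta>)) \<longlongrightarrow> l) (at_left x)"
proof -
  have const: "\<exists>l. ((\<lambda>\<theta>. g (rho \<theta>)) \<longlongrightarrow> l) (at_left x)" if "p < x" "\<And>\<theta>. p < \<theta> \<Longrightarrow> \<theta> < x \<Longrightarrow> rho \<theta> = q" for p q
  proof (rule exI, rule tendsto_eventually)
    show "\<forall>\<^sub>F \<theta> in at_left x. g (rho \<theta>) = g q"
      unfolding eventually_at_left_field using that by (intro exI[of _ p]) auto
  qed
  show ?thesis
  proof (cases "x \<le> a")
    case True
    then show ?thesis by (intro const[of "x - 1" a]) (auto intro: rho_start)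
  next
    case ax: False
    show ?thesis
    proof (cases "x \<in> X")
      case False
      have "rho x < x" using rho_le[of x] rho_in[of x] False ax by (metis linorder_not_le order_le_less)
      moreover have "x < sigma X (rho x)"
        using rho_gap[OF \<open>rho x < x\<close>] sigma_in[of "rho x"] False by (metis order_le_less)
      ultimately show ?thesis
        by (intro const[of "rho x" "rho x"]) (auto intro!: rho_eq rho_in)
    next
      case xX: True
      show ?thesis
      proof (cases "x islimpt (X \<inter> {..<x})")
        case False
        then obtain p where "p \<in> X" "p < x" "sigma X p = x" using left_gap[OF xX] ax by auto
        then show ?thesis by (intro const[of p p]) (auto intro!: rho_eq)
      next
        case True
        then have "x \<in> left_dense X" using xX by (simp add: left_dense_def)
        then obtain l where l: "(g \<longlongrightarrow> l) (at x within (X \<inter> {..<x}))"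
          using assms unfolding rd_continuous_def by blast
        have "filterlim rho (at x within (X \<inter> {..<x})) (at_left x)"
          unfolding filterlim_at
        proof (intro conjI)
          have "\<forall>\<^sub>F \<theta> in at_left x. a < \<theta> \<and> \<theta> < x"
            unfolding eventually_at_left_field using ax by (intro exI[of _ a]) auto
          then show "\<forall>\<^sub>F \<theta> in at_left x. rho \<theta> \<in> X \<inter> {..<x} \<and> rho \<theta> \<noteq> x"
            by eventually_elim (use rho_in rho_le in \<open>force dest: rho_le[OF less_imp_le]\<close>)
          show "(rho \<longlongrightarrow> x) (at_left x)"
          proof (rule order_tendstoI)
            fix y assume "y < x"
            then obtain t where t: "t \<in> X" "t < x" "y < t"
              using True unfolding islimpt_def
              by (metis Int_iff greaterThan_iff lessThan_iff open_greaterThan)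
            have "\<forall>\<^sub>F \<theta> in at_left x. t < \<theta>"
              unfolding eventually_at_left_field using t by auto
            then show "\<forall>\<^sub>F \<theta> in at_left x. y < rho \<theta>"
              by eventually_elim (rule less_le_trans[OF t(3) rho_upper[OF t(1) less_imp_le]])
          next
            fix y assume y: "x < y"
            have "\<forall>\<^sub>F \<theta> in at_left x. a < \<theta> \<and> \<theta> < x"
              unfolding eventually_at_left_field using ax by (intro exI[of _ a]) auto
            then show "\<forall>\<^sub>F \<theta> in at_left x. rho \<theta> < y"
              by eventually_elim (rule le_less_trans[OF rho_le], use y in auto)
          qed
        qed
        from filterlim_compose[OF l this] show ?thesis by blast
      qed
    qed
  qed
qed

lemma rd_continuous_right_limit:
  fixes g :: "real \<Rightarrow> 'b::topological_space"
  assumes "rd_continuous X g"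
  shows "\<exists>l. ((\<lambda>\<theta>. g (rho \<theta>)) \<longlongrightarrow> l) (at_right x)"
proof -
  have const: "\<exists>l. ((\<lambda>\<theta>. g (rho \<theta>)) \<longlongrightarrow> l) (at_right x)" if "x < p" "\<And>\<theta>. x < \<theta> \<Longrightarrow> \<theta> < p \<Longrightarrow> rho \<theta> = q" for p q
  proof (rule exI, rule tendsto_eventually)
    show "\<forall>\<^sub>F \<theta> in at_right x. g (rho \<theta>) = g q"
      unfolding eventually_at_right_field using that by (intro exI[of _ p]) auto
  qed
  show ?thesis
  proof (cases "x < a")
    case True
    then show ?thesis by (intro const[of a a]) (auto intro: rho_start)
  next
    case ax: False
    show ?thesis
    proof (cases "x < sigma X (rho x)")
      case True
      then show ?thesis
        using rho_le[of x] ax by (intro const[of "sigma X (rho x)" "rho x"]) (auto intro!: rho_eq rho_in)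
    next
      case False
      \<comment> \<open>When \<open>rho\<close> is not constant just to the right of x, no gap opens
        at \<open>rho x\<close>. Hence x equals \<open>rho x\<close> and is right-dense, so that
        continuity of g within X applies.\<close>
      then have s: "sigma X (rho x) = rho x"
        using rho_upper[OF sigma_in, of "rho x" x] sigma_ge[of "rho x"] by simp
      have xr: "rho x = x"
      proof (rule ccontr)
        assume "rho x \<noteq> x"
        then have "rho x < x" using rho_le[of x] ax by simp
        then show False using rho_gap[of x] s by simp
      qed
      then have xX: "x \<in> X" and sx: "sigma X x = x" using rho_in[of x] s by auto
      then have "x \<in> right_dense X" by (simp add: right_dense_def)
      then have l: "(g \<longlongrightarrow> g x) (at x within X)"
        using assms unfolding rd_continuous_def by blast
      have "filterlim rho (at x within X) (at_right x)"
        unfolding filterlim_at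
      proof (intro conjI)
        have "rho \<theta> \<noteq> x" if "x < \<theta>" for \<theta> using right_dense_near[OF sx that] rho_upper[of _ \<theta>] by fastforce
        then show "\<forall>\<^sub>F \<theta> in at_right x. rho \<theta> \<in> X \<and> rho \<theta> \<noteq> x"
          unfolding eventually_at_right_field using rho_in by (intro exI[of _ "x + 1"]) auto
        show "(rho \<longlongrightarrow> x) (at_right x)"
        proof (rule order_tendstoI)
          fix y assume y: "y < x"
          have "\<forall>\<^sub>F \<theta> in at_right x. x < \<theta>" by (rule eventually_at_right_less)
          then show "\<forall>\<^sub>F \<theta> in at_right x. y < rho \<theta>"
            by eventually_elim (rule less_le_trans[OF y rho_upper[OF xX less_imp_le]])
        next
          fix y assume "x < y"
          then have "\<forall>\<^sub>F \<theta> in at_right x. x < \<theta> \<and> \<theta> < y"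
            unfolding eventually_at_right_field by auto
          then show "\<forall>\<^sub>F \<theta> in at_right x. rho \<theta> < y"
            by eventually_elim (rule le_less_trans[OF rho_le], use ax in auto)
        qed
      qed
      from filterlim_compose[OF l this] show ?thesis by blast
    qed
  qed
qed

lemma rd_continuous_integrable:
  fixes g :: "real \<Rightarrow> 'b::banach"
  assumes "rd_continuous X g"
  shows "(\<lambda>\<theta>. g (rho \<theta>)) integrable_on {c..d}"
  by (rule regulated_integrable) (rule rd_continuous_left_limit[OF assms] rd_continuous_right_limit[OF assms])+

text \<open>This supplies the antiderivatives behind every delta integral below. Across a gap the
  extended integrand is constant; at a right-dense point it is within \<epsilon> of
  \<open>g t\<close> on a whole interval around t.\<close>

lemma delta_derivative_integral:
  fixes g :: "real \<Rightarrow> 'b::banach"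
  assumes rd: "rd_continuous X g" and tX: "t \<in> X"
  shows "has_delta_derivative X (\<lambda>t. integral {a..t} (\<lambda>\<theta>. g (rho \<theta>))) t (g t)"
proof -
  let ?h = "\<lambda>\<theta>. g (rho \<theta>)"
  define G where "G = (\<lambda>t. integral {a..t} ?h)"
  have int: "?h integrable_on {c..d}" for c d by (rule rd_continuous_integrable[OF rd])
  have G: "G q - G p = integral {p..q} ?h" if "a \<le> p" "p \<le> q" for p q
    using Henstock_Kurzweil_Integration.integral_combine[OF that int] by (simp add: G_def algebra_simps)
  have est: "norm (G q - G p - (q - p) *\<^sub>R g t) \<le> \<epsilon> * (q - p)"
    if "a \<le> p" "p \<le> q" "\<And>\<theta>. \<theta> \<in> {p..q} \<Longrightarrow> norm (?h \<theta> - g t) \<le> \<epsilon>" for p q \<epsilon>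
  proof -
    have "integral {p..q} (\<lambda>\<theta>. ?h \<theta> - g t) = G q - G p - (q - p) *\<^sub>R g t"
      using that by (subst Henstock_Kurzweil_Integration.integral_diff) (auto simp: G int)
    moreover have "norm (integral {p..q} (\<lambda>\<theta>. ?h \<theta> - g t)) \<le> integral {p..q} (\<lambda>\<theta>. \<epsilon>)"
      by (rule integral_norm_bound_integral) (use that int in \<open>auto intro!: Henstock_Kurzweil_Integration.integrable_diff\<close>)
    ultimately show ?thesis using that by (simp add: mult.commute)
  qed
  have aT: "a \<le> t" using start_le tX by blast
  have "has_delta_derivative X G t (g t)"
    unfolding has_delta_derivative_def
  proof (intro allI impI)
    fix \<epsilon> :: real assume e: "\<epsilon> > 0"
    show "\<exists>W. open W \<and> t \<in> W \<and> (\<forall>s\<in>W \<inter> X.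
        norm (G (sigma X t) - G s - (sigma X t - s) *\<^sub>R g t) \<le> \<epsilon> * \<bar>sigma X t - s\<bar>)"
    proof (cases "t < sigma X t")
      case True
      \<comment> \<open>The integrands agree on the gap except possibly at its right end, where
        \<open>rho\<close> has moved on to \<open>sigma X t\<close>.\<close>
      have "integral {t..sigma X t} ?h = integral {t..sigma X t} (\<lambda>_. g t)"
        by (rule integral_spike[of "{sigma X t}"]) (auto simp: rho_eq[OF tX])
      then have Gs: "G (sigma X t) - G t = (sigma X t - t) *\<^sub>R g t"
        using G[OF aT, of "sigma X t"] True by simp
      \<comment> \<open>Only test points s <= t remain near t, and for them the permitted error is
        at least \<epsilon> times the length of the gap, a fixed positive number. Continuity of G is
        therefore enough.\<close>
      have "continuous_on {a..t} G" unfolding G_def by (rule indefinite_integral_continuous_1[OF int])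
      then have "continuous_on {a..t} (\<lambda>s. G s - s *\<^sub>R g t)" by (intro continuous_intros)
      moreover have "\<epsilon> * (sigma X t - t) > 0" using e True by simp
      ultimately obtain d where d: "d > 0"
        "\<And>s. s \<in> {a..t} \<Longrightarrow> dist s t < d \<Longrightarrow> dist (G s - s *\<^sub>R g t) (G t - t *\<^sub>R g t) < \<epsilon> * (sigma X t - t)"
        using aT unfolding continuous_on_iff by (meson atLeastAtMost_iff order_refl)
      have "norm (G (sigma X t) - G s - (sigma X t - s) *\<^sub>R g t) \<le> \<epsilon> * \<bar>sigma X t - s\<bar>"
        if s: "s \<in> (ball t d \<inter> {..<sigma X t}) \<inter> X" for s
      proof -
        have st: "s \<le> t" using s sigma_le[of s t] by force
        have eq: "G (sigma X t) - G s - (sigma X t - s) *\<^sub>R g t = (G t - t *\<^sub>R g t) - (G s - s *\<^sub>R g t)"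
          using Gs by (simp add: algebra_simps)
        have "dist (G s - s *\<^sub>R g t) (G t - t *\<^sub>R g t) < \<epsilon> * (sigma X t - t)"
          using s st start_le[of s] by (intro d(2)) (auto simp: dist_commute)
        then have "norm (G (sigma X t) - G s - (sigma X t - s) *\<^sub>R g t) \<le> \<epsilon> * (sigma X t - t)"
          unfolding eq by (simp add: dist_norm norm_minus_commute)
        also have "\<dots> \<le> \<epsilon> * \<bar>sigma X t - s\<bar>" using e st True by simp
        finally show ?thesis .
      qed
      then show ?thesis using d(1) True by (intro exI[of _ "ball t d \<inter> {..<sigma X t}"]) auto
    next
      case False
      then have sg: "sigma X t = t" using sigma_ge[of t] by simp
      then have "(g \<longlongrightarrow> g t) (at t within X)" using rd tX unfolding rd_continuous_def right_dense_def by auto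
      then have "\<forall>\<^sub>F s in at t within X. dist (g s) (g t) < \<epsilon>" using e by (rule tendstoD)
      then obtain d where d: "d > 0" "\<And>s. s \<in> X \<Longrightarrow> s \<noteq> t \<Longrightarrow> dist s t < d \<Longrightarrow> dist (g s) (g t) < \<epsilon>"
        unfolding eventually_at by blast
      have g: "norm (g s - g t) \<le> \<epsilon>" if "s \<in> X" "\<bar>s - t\<bar> < d" for s
        using d(2)[of s] that e by (cases "s = t") (auto simp: dist_norm less_imp_le)
      have "norm (G t - G s - (t - s) *\<^sub>R g t) \<le> \<epsilon> * \<bar>t - s\<bar>" if s: "s \<in> ball t d \<inter> X" for s
      proof (cases "s \<le> t")
        case True
        have "norm (G t - G s - (t - s) *\<^sub>R g t) \<le> \<epsilon> * (t - s)"
        proof (rule est)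
          fix \<theta> assume th: "\<theta> \<in> {s..t}"
          have "s \<le> rho \<theta>" using rho_upper[of s \<theta>] th s by auto
          moreover have "rho \<theta> \<le> t" using rho_le[of \<theta>] th start_le[of s] s by auto
          ultimately show "norm (g (rho \<theta>) - g t) \<le> \<epsilon>" using s by (intro g[OF rho_in]) (auto simp: dist_real_def)
        qed (use s True start_le in auto)
        then show ?thesis using True by simp
      next
        case False
        have "norm (G s - G t - (s - t) *\<^sub>R g t) \<le> \<epsilon> * (s - t)"
        proof (rule est)
          fix \<theta> assume th: "\<theta> \<in> {t..s}"
          have "t \<le> rho \<theta>" using rho_upper[of t \<theta>] th tX by auto
          moreover have "rho \<theta> \<le> s" using rho_le[of \<theta>] th aT by auto
          ultimately show "norm (g (rho \<theta>) - g t) \<le> \<epsilon>" using s by (intro g[OF rho_in]) (auto simp: dist_real_def)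
        qed (use False aT in auto)
        moreover have "G t - G s - (t - s) *\<^sub>R g t = - (G s - G t - (s - t) *\<^sub>R g t)" by (simp add: algebra_simps)
        ultimately show ?thesis using False by (metis norm_minus_cancel abs_minus_commute abs_of_pos linorder_not_le diff_gt_0_iff_gt)
      qed
      then show ?thesis unfolding sg using d(1) by (intro exI[of _ "ball t d"]) auto
    qed
  qed
  then show ?thesis by (simp add: G_def)
qed

text \<open>The definite description in \<open>delta_integral\<close> is legitimate because two
  antiderivatives differ by a constant.\<close>

lemma delta_integral_eq:
  assumes F: "\<And>t. t \<in> X \<Longrightarrow> has_delta_derivative X F t (f t)" and "s \<in> X" "t \<in> X"
  shows "delta_integral X f s t = F t - F s"
  unfolding delta_integral_def
proof (rule the_equality)
  show "\<exists>G. (\<forall>t\<in>X. has_delta_derivative X G t (f t)) \<and> F t - F s = G t - G s" using F by blast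
  fix I assume "\<exists>G. (\<forall>t\<in>X. has_delta_derivative X G t (f t)) \<and> I = G t - G s"
  then obtain G where G: "\<And>t. t \<in> X \<Longrightarrow> has_delta_derivative X G t (f t)" "I = G t - G s" by blast
  have "has_delta_derivative X (\<lambda>t. G t - F t) t 0" if "t \<in> X" for t
    using has_delta_derivative_diff[OF G(1)[OF that] F[OF that]] by simp
  then have "G t - F t = G a - F a" "G s - F s = G a - F a"
    using zero_delta_derivative_const[of "\<lambda>t. G t - F t"] assms by blast+
  then show "I = F t - F s" using G(2) by simp
qed

end

lemma rd_continuous_subset:
  assumes "rd_continuous X f" "X' \<subseteq> X" "\<And>t. t \<in> X' \<Longrightarrow> sigma X' t = sigma X t"
  shows "rd_continuous X' f"
  unfolding rd_continuous_def
proof (intro conjI ballI)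
  fix t assume "t \<in> right_dense X'"
  then have "t \<in> right_dense X" using assms(2,3) by (auto simp: right_dense_def)
  then show "(f \<longlongrightarrow> f t) (at t within X')"
    using assms(1,2) unfolding rd_continuous_def by (blast intro: tendsto_within_subset)
next
  fix t assume "t \<in> left_dense X'"
  then have "t \<in> left_dense X"
    using assms(2) by (auto simp: left_dense_def elim: islimpt_subset)
  then obtain l where "(f \<longlongrightarrow> l) (at t within (X \<inter> {..<t}))"
    using assms(1) unfolding rd_continuous_def by blast
  then have "(f \<longlongrightarrow> l) (at t within (X' \<inter> {..<t}))"
    by (rule tendsto_within_subset) (use assms(2) in blast)
  then show "\<exists>l. (f \<longlongrightarrow> l) (at t within (X' \<inter> {..<t}))" by blast
qed

lemma rd_continuous_bilinear:
  assumes "bounded_bilinear p" "rd_continuous X f" "continuous_on UNIV g"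
  shows "rd_continuous X (\<lambda>t. p (f t) (g t))"
proof -
  have g: "(g \<longlongrightarrow> g t) (at t within S)" for t S
    using assms(3) by (simp add: continuous_on_eq_continuous_at isCont_def tendsto_within_subset[OF _ subset_UNIV])
  show ?thesis
    unfolding rd_continuous_def
  proof (intro conjI ballI)
    fix t assume "t \<in> right_dense X"
    then have "(f \<longlongrightarrow> f t) (at t within X)" using assms(2) unfolding rd_continuous_def by blast
    then show "((\<lambda>t. p (f t) (g t)) \<longlongrightarrow> p (f t) (g t)) (at t within X)"
      using bounded_bilinear.tendsto[OF assms(1)] g by blast
  next
    fix t assume "t \<in> left_dense X"
    then obtain l where "(f \<longlongrightarrow> l) (at t within (X \<inter> {..<t}))" using assms(2) unfolding rd_continuous_def by blast
    from bounded_bilinear.tendsto[OF assms(1) this g]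
    show "\<exists>l. ((\<lambda>t. p (f t) (g t)) \<longlongrightarrow> l) (at t within (X \<inter> {..<t}))" by blast
  qed
qed

section \<open>Linear initial value problems\<close>

context ts_ray
begin

lemma has_delta_derivative_cong:
  assumes "has_delta_derivative X F t d" "\<And>s. s \<in> X \<Longrightarrow> F s = G s"
  shows "has_delta_derivative X G t d"
  using assms sigma_in[of t] unfolding has_delta_derivative_def by simp

text \<open>
  Banach's fixed point theorem for the integral equation, in the norm weighted by
  \<open>exp (- lam * (t - a))\<close>, which makes the integral operator a contraction on the whole ray.
\<close>

lemma linear_ivp_exists:
  fixes p :: "'a::real_normed_vector \<Rightarrow> 'b::banach \<Rightarrow> 'b"
  assumes bil: "bounded_bilinear p" and rd: "rd_continuous X A"
    and bd: "\<And>t. t \<in> X \<Longrightarrow> norm (A t) \<le> M"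
  shows "\<exists>Y. Y a = y0 \<and> (\<forall>t\<in>X. has_delta_derivative X Y t (p (A t) (Y t)))"
proof -
  interpret p: bounded_bilinear p by fact
  obtain L where L: "L > 0" "\<And>x y. norm (p x y) \<le> norm x * norm y * L" using p.pos_bounded by blast
  have M0: "M \<ge> 0" using bd[OF start_in] norm_ge_zero[of "A a"] by linarith
  define m where "m = M * L"
  have m0: "m \<ge> 0" using M0 L(1) by (simp add: m_def)
  \<comment> \<open>Integrating the weight \<open>E\<close> divides it by \<open>lam\<close>, so the
    contraction factor is m / lam <= 1/2; the summand 1 keeps \<open>lam\<close> positive when m =
    0.\<close>
  define lam where "lam = 2 * m + 1"
  have lam: "lam > 0" using m0 by (simp add: lam_def)
  define E where "E = (\<lambda>\<theta>. exp (lam * (\<theta> - a)))"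
  have E0: "E \<theta> > 0" for \<theta> by (simp add: E_def)
  have Emono: "E s \<le> E t" if "s \<le> t" for s t using that lam by (simp add: E_def)
  have Eint: "(E has_integral (E t - E a) / lam) {a..t}" if "a \<le> t" for t
  proof -
    have "(E has_integral E t / lam - E a / lam) {a..t}"
    proof (rule fundamental_theorem_of_calculus[OF that])
      fix x
      show "((\<lambda>x. E x / lam) has_vector_derivative E x) (at x within {a..t})"
        unfolding E_def has_real_derivative_iff_has_vector_derivative[symmetric]
        using lam by (auto intro!: derivative_eq_intros)
    qed
    then show ?thesis by (simp add: diff_divide_distrib)
  qed
  \<comment> \<open>The unknown is z = Y / E. The exponential weight makes it bounded, so it can be
    sought in the complete space of bounded continuous functions.\<close>
  define g where "g = (\<lambda>(z :: real \<Rightarrow>\<^sub>C 'b) t. p (A t) (E t *\<^sub>R apply_bcontfun z t))"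
  define I where "I = (\<lambda>z t. integral {a..t} (\<lambda>\<theta>. g z (rho \<theta>)))"
  have rdg: "rd_continuous X (g z)" for z
    unfolding g_def E_def
    by (rule rd_continuous_bilinear[OF bil rd]) (intro continuous_intros continuous_on_apply_bcontfun)
  have int: "(\<lambda>\<theta>. g z (rho \<theta>)) integrable_on {c..d}" for z c d by (rule rd_continuous_integrable[OF rdg])
  have Idiff: "norm (I z t - I z' t) \<le> dist z z' / 2 * E t" if t: "a \<le> t" for z z' t
  proof -
    have "I z t - I z' t = integral {a..t} (\<lambda>\<theta>. g z (rho \<theta>) - g z' (rho \<theta>))"
      unfolding I_def by (subst Henstock_Kurzweil_Integration.integral_diff) (auto intro: int)
    also have "norm \<dots> \<le> integral {a..t} (\<lambda>\<theta>. m * dist z z' * E \<theta>)"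
    proof (rule integral_norm_bound_integral)
      show "(\<lambda>\<theta>. g z (rho \<theta>) - g z' (rho \<theta>)) integrable_on {a..t}"
        by (intro Henstock_Kurzweil_Integration.integrable_diff int)
      show "(\<lambda>\<theta>. m * dist z z' * E \<theta>) integrable_on {a..t}"
        using Eint[OF t] by (intro integrable_on_mult_right) blast
      fix \<theta> assume th: "\<theta> \<in> {a..t}"
      let ?r = "rho \<theta>"
      have "g z ?r - g z' ?r = p (A ?r) (E ?r *\<^sub>R (apply_bcontfun z ?r - apply_bcontfun z' ?r))"
        by (simp add: g_def p.diff_right scaleR_diff_right)
      then have "norm (g z ?r - g z' ?r) \<le> norm (A ?r) * norm (E ?r *\<^sub>R (apply_bcontfun z ?r - apply_bcontfun z' ?r)) * L"
        using L(2) by metis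
      also have "\<dots> = norm (A ?r) * (E ?r * dist (apply_bcontfun z ?r) (apply_bcontfun z' ?r)) * L"
        using E0[of ?r] by (simp add: dist_norm)
      also have "\<dots> \<le> M * (E \<theta> * dist z z') * L"
      proof (intro mult_right_mono mult_mono)
        show "norm (A ?r) \<le> M" by (rule bd[OF rho_in])
        show "E ?r \<le> E \<theta>" using th by (intro Emono rho_le) simp
        show "dist (apply_bcontfun z ?r) (apply_bcontfun z' ?r) \<le> dist z z'" by (rule dist_bounded)
      qed (use M0 L(1) in \<open>auto intro!: mult_nonneg_nonneg less_imp_le[OF E0]\<close>)
      finally show "norm (g z ?r - g z' ?r) \<le> m * dist z z' * E \<theta>" by (simp add: m_def algebra_simps)
    qed
    also have "\<dots> = m * dist z z' * ((E t - E a) / lam)"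
      using integral_unique[OF Eint[OF t]] by simp
    also have "\<dots> \<le> m * dist z z' * (E t / lam)"
      using m0 lam E0[of a] by (intro mult_left_mono divide_right_mono) auto
    also have "\<dots> = (m / lam) * (dist z z' * E t)" by simp
    also have "\<dots> \<le> (1 / 2) * (dist z z' * E t)"
    proof (rule mult_right_mono)
      show "m / lam \<le> 1 / 2" using lam by (simp add: lam_def field_simps)
    qed (use E0[of t] in simp)
    finally show ?thesis by simp
  qed
  \<comment> \<open>\<open>max a t\<close> extends the iterate constantly to the left of the ray,
    since bounded continuous functions here live on the whole line.\<close>
  define K where "K = (\<lambda>z t. (1 / E (max a t)) *\<^sub>R (y0 + I z (max a t)))"
  have I0: "I 0 t = 0" for t by (simp add: I_def g_def p.zero_right)
  have Kb: "K z \<in> bcontfun" for z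
  proof (rule bcontfun_normI)
    have "isCont (\<lambda>t. I z (max a t)) x" for x
    proof -
      have "continuous_on {x - 1<..<x + 1} (\<lambda>t. I z (max a t))"
        unfolding I_def
        by (rule continuous_on_compose2[OF indefinite_integral_continuous_1[OF int, of a "max a (x + 1)"]])
          (auto intro!: continuous_intros)
      then show ?thesis by (simp add: continuous_on_eq_continuous_at)
    qed
    then have "continuous_on UNIV (\<lambda>t. I z (max a t))" by (simp add: continuous_at_imp_continuous_on)
    then show "continuous_on UNIV (K z)" unfolding K_def E_def by (intro continuous_intros) auto
    fix t
    let ?t = "max a t"
    have "E ?t \<ge> 1" using Emono[of a ?t] by (simp add: E_def)
    have "norm (K z t) = norm (y0 + I z ?t) / E ?t" using E0[of ?t] by (simp add: K_def)
    also have "\<dots> \<le> (norm y0 + dist z 0 / 2 * E ?t) / E ?t"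
      using Idiff[of ?t z 0] E0[of ?t] norm_triangle_ineq[of y0 "I z ?t"]
      by (intro divide_right_mono) (auto simp: I0)
    also have "\<dots> = norm y0 / E ?t + dist z 0 / 2" using E0[of ?t] by (simp add: field_simps)
    also have "\<dots> \<le> norm y0 + dist z 0 / 2" using \<open>E ?t \<ge> 1\<close> by (simp add: divide_le_eq mult_le_cancel_left1)
    finally show "norm (K z t) \<le> norm y0 + dist z 0 / 2" .
  qed
  define KK where "KK = (\<lambda>z. Bcontfun (K z))"
  have KK: "apply_bcontfun (KK z) = K z" for z unfolding KK_def using Kb by (simp add: Bcontfun_inverse)
  have "dist (KK z) (KK z') \<le> 1 / 2 * dist z z'" for z z'
  proof (rule dist_bound)
    fix t
    let ?t = "max a t"
    have "K z t - K z' t = (1 / E ?t) *\<^sub>R (I z ?t - I z' ?t)" by (simp add: K_def algebra_simps)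
    then have "norm (K z t - K z' t) = norm (I z ?t - I z' ?t) / E ?t" using E0[of ?t] by simp
    also have "\<dots> \<le> (dist z z' / 2 * E ?t) / E ?t"
      using Idiff[of ?t z z'] E0[of ?t] by (intro divide_right_mono) auto
    also have "\<dots> = 1 / 2 * dist z z'" using E0[of ?t] by simp
    finally show "dist (apply_bcontfun (KK z) t) (apply_bcontfun (KK z') t) \<le> 1 / 2 * dist z z'"
      by (simp add: KK dist_norm)
  qed
  then have "\<exists>!z. KK z = z" by (intro banach_fix_type[of "1 / 2"]) auto
  then obtain z where z: "KK z = z" by blast
  have zY: "E t *\<^sub>R apply_bcontfun z t = y0 + I z t" if "t \<in> X" for t
  proof -
    have "max a t = t" using start_le[OF that] by simp
    then have "K z t = (1 / E t) *\<^sub>R (y0 + I z t)" by (simp add: K_def)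
    then show ?thesis using KK[of z] z E0[of t] by simp
  qed
  \<comment> \<open>The sum is written as a difference so that
    \<open>has_delta_derivative_diff\<close> applies.\<close>
  define Y where "Y = (\<lambda>t. I z t - (- y0))"
  have "has_delta_derivative X Y t (p (A t) (Y t))" if "t \<in> X" for t
  proof -
    have "has_delta_derivative X Y t (g z t - 0)"
      unfolding Y_def I_def
      by (intro has_delta_derivative_diff has_delta_derivative_const delta_derivative_integral rdg that)
    moreover have "g z t = p (A t) (Y t)" using zY[OF that] by (simp add: g_def Y_def add.commute)
    ultimately show ?thesis by simp
  qed
  moreover have "Y a = y0" by (simp add: Y_def I_def)
  ultimately show ?thesis by blast
qed

text \<open>The difference of two solutions starts at 0 and satisfies the hypothesis of
  \<open>delta_growth\<close> with c = 0.\<close>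

lemma linear_ivp_unique:
  fixes p :: "'a::real_normed_vector \<Rightarrow> 'b::real_normed_vector \<Rightarrow> 'b"
  assumes bil: "bounded_bilinear p" and bd: "\<And>t. t \<in> X \<Longrightarrow> norm (A t) \<le> M"
    and Y: "\<And>t. t \<in> X \<Longrightarrow> has_delta_derivative X Y t (p (A t) (Y t))"
    and Z: "\<And>t. t \<in> X \<Longrightarrow> has_delta_derivative X Z t (p (A t) (Z t))"
    and "Y a = Z a" "t \<in> X"
  shows "Y t = Z t"
proof -
  interpret p: bounded_bilinear p by fact
  obtain L where L: "L > 0" "\<And>x y. norm (p x y) \<le> norm x * norm y * L" using p.pos_bounded by blast
  have M0: "M \<ge> 0" using bd[OF start_in] norm_ge_zero[of "A a"] by linarith
  have "norm (Y t - Z t) \<le> (norm (Y a - Z a) + 0 * (t - a)) * exp (M * L * (t - a))"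
  proof (rule delta_growth[where J = X and F' = "\<lambda>t. p (A t) (Y t) - p (A t) (Z t)"])
    show "has_delta_derivative X (\<lambda>t. Y t - Z t) t (p (A t) (Y t) - p (A t) (Z t))" if "t \<in> X" for t
      by (intro has_delta_derivative_diff Y Z that)
    fix t assume t: "t \<in> X"
    have "norm (p (A t) (Y t - Z t)) \<le> norm (A t) * norm (Y t - Z t) * L" by (rule L(2))
    also have "\<dots> \<le> M * norm (Y t - Z t) * L" using bd[OF t] L(1) by (intro mult_right_mono) auto
    finally show "norm (p (A t) (Y t) - p (A t) (Z t)) \<le> M * L * norm (Y t - Z t) + 0"
      by (simp add: p.diff_right algebra_simps)
  qed (use M0 L(1) assms in auto)
  then show ?thesis using assms(5) by simp
qed

end

section \<open>Vector norms\<close>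

lemma vector_norm_props:
  assumes "vector_norm N"
  shows vector_norm_ge_0: "0 \<le> N x" and vector_norm_eq_0: "N x = 0 \<longleftrightarrow> x = 0"
    and vector_norm_scaleR: "N (c *\<^sub>R x) = \<bar>c\<bar> * N x"
    and vector_norm_triangle: "N (x + y) \<le> N x + N y"
  using assms unfolding vector_norm_def by blast+

lemma vector_norm_zero: "vector_norm N \<Longrightarrow> N 0 = 0"
  by (simp add: vector_norm_eq_0)

lemma vector_norm_sum:
  assumes "vector_norm N"
  shows "N (\<Sum>b\<in>S. c b *\<^sub>R b) \<le> (\<Sum>b\<in>S. \<bar>c b\<bar> * N b)"
proof (induction S rule: infinite_finite_induct)
  case (insert b S)
  have "N (c b *\<^sub>R b + (\<Sum>b\<in>S. c b *\<^sub>R b)) \<le> N (c b *\<^sub>R b) + N (\<Sum>b\<in>S. c b *\<^sub>R b)"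
    by (rule vector_norm_triangle[OF assms])
  also have "N (c b *\<^sub>R b) = \<bar>c b\<bar> * N b" by (rule vector_norm_scaleR[OF assms])
  finally show ?case using insert by simp
qed (simp_all add: vector_norm_zero[OF assms])

lemma vector_norm_upper:
  fixes N :: "real ^ 'n \<Rightarrow> real"
  assumes "vector_norm N"
  obtains k where "k > 0" "\<And>x. N x \<le> k * norm x"
proof
  note N0 = vector_norm_ge_0[OF assms]
  let ?k = "(\<Sum>b\<in>Basis. N b) + 1"
  show "?k > 0" using sum_nonneg[of Basis N] N0 by fastforce
  fix x :: "real ^ 'n"
  have "N x \<le> (\<Sum>b\<in>Basis. \<bar>x \<bullet> b\<bar> * N b)"
    using vector_norm_sum[OF assms, of "\<lambda>b. x \<bullet> b" Basis] by (simp add: euclidean_representation)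
  also have "\<dots> \<le> (\<Sum>b\<in>Basis. norm x * N b)"
    by (intro sum_mono mult_right_mono Basis_le_norm N0)
  also have "\<dots> = norm x * (\<Sum>b\<in>Basis. N b)" by (simp add: sum_distrib_left)
  also have "\<dots> \<le> ?k * norm x" by (simp add: algebra_simps)
  finally show "N x \<le> ?k * norm x" .
qed

lemma vector_norm_diff_bound:
  assumes "vector_norm N"
  shows "\<bar>N x - N y\<bar> \<le> N (x - y)"
proof -
  have "N (y - x) = N ((-1) *\<^sub>R (x - y))" by simp
  also have "\<dots> = N (x - y)" unfolding vector_norm_scaleR[OF assms] by simp
  finally have "N (y - x) = N (x - y)" .
  then show ?thesis
    using vector_norm_triangle[OF assms, of "x - y" y] vector_norm_triangle[OF assms, of "y - x" x] by simp
qed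

lemma vector_norm_tendsto:
  assumes "vector_norm N" "(f \<longlongrightarrow> l) F"
  shows "((\<lambda>x. N (f x)) \<longlongrightarrow> N l) F"
proof -
  obtain k where k: "k > 0" "\<And>x. N x \<le> k * norm x" using vector_norm_upper[OF assms(1)] by blast
  have "((\<lambda>x. k * norm (f x - l)) \<longlongrightarrow> k * norm (l - l)) F" by (intro tendsto_intros assms(2))
  then have "((\<lambda>x. k * norm (f x - l)) \<longlongrightarrow> 0) F" by simp
  then have "((\<lambda>x. N (f x) - N l) \<longlongrightarrow> 0) F"
    by (rule Lim_null_comparison[rotated])
      (auto intro!: always_eventually order_trans[OF vector_norm_diff_bound[OF assms(1)] k(2)])
  then show ?thesis by (simp add: LIM_zero_iff)
qed

text \<open>By compactness N attains its minimum on the Euclidean unit sphere. This minimum is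
  positive and bounds N from below by homogeneity.\<close>

lemma vector_norm_lower:
  fixes N :: "real ^ 'n \<Rightarrow> real"
  assumes "vector_norm N"
  obtains k where "k > 0" "\<And>x. norm x \<le> k * N x"
proof -
  have "continuous_on (sphere 0 1) N"
    unfolding continuous_on_def using vector_norm_tendsto[OF assms tendsto_ident_at] by auto
  moreover have "sphere (0 :: real ^ 'n) 1 \<noteq> {}" by simp
  ultimately obtain y where y: "norm y = 1" "\<And>x. norm x = 1 \<Longrightarrow> N y \<le> N x"
    using continuous_attains_inf[OF compact_sphere, of 0 1 N] by auto
  have Ny: "N y > 0" using vector_norm_ge_0[OF assms, of y] vector_norm_eq_0[OF assms, of y] y(1) by fastforce
  have "norm x \<le> (1 / N y) * N x" for x
  proof (cases "x = 0")
    case True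
    then show ?thesis by (simp add: vector_norm_zero[OF assms])
  next
    case False
    then have "N y \<le> N ((1 / norm x) *\<^sub>R x)" by (intro y(2)) simp
    also have "\<dots> = N x / norm x" by (simp add: vector_norm_scaleR[OF assms])
    finally show ?thesis using False Ny by (simp add: field_simps)
  qed
  then show thesis using that[of "1 / N y"] Ny by auto
qed

text \<open>The real supremum in \<open>operator_norm\<close> is meaningful only for a bounded set
  of quotients; equivalence of N with the Euclidean norm provides the bound.\<close>

lemma operator_norm_bound:
  fixes N :: "real ^ 'n \<Rightarrow> real"
  assumes "vector_norm N"
  shows "N (B *v x) \<le> operator_norm N B * N x"
proof (cases "x = 0")
  case True
  then show ?thesis by (simp add: vector_norm_zero[OF assms])
next
  case False
  have N0: "N y > 0" if "y \<noteq> 0" for y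
    using vector_norm_ge_0[OF assms, of y] vector_norm_eq_0[OF assms, of y] that by simp
  obtain k where k: "k > 0" "\<And>x. N x \<le> k * norm x" using vector_norm_upper[OF assms] by blast
  obtain l where l: "l > 0" "\<And>x. norm x \<le> l * N x" using vector_norm_lower[OF assms] by blast
  have "N (B *v y) / N y \<le> k * onorm ((*v) B) * l" if "y \<in> - {0}" for y
  proof -
    have "N (B *v y) \<le> k * norm (B *v y)" by (rule k)
    also have "\<dots> \<le> k * (onorm ((*v) B) * norm y)"
      using k by (intro mult_left_mono onorm matrix_vector_mul_bounded_linear) auto
    also have "\<dots> \<le> k * (onorm ((*v) B) * (l * N y))"
      using k l(2) onorm_pos_le[OF matrix_vector_mul_bounded_linear] by (intro mult_left_mono) auto
    finally show ?thesis using N0[of y] that by (simp add: divide_le_eq ac_simps)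
  qed
  then have "bdd_above ((\<lambda>y. N (B *v y) / N y) ` (- {0}))" by (intro bdd_aboveI2)
  then have "N (B *v x) / N x \<le> operator_norm N B"
    unfolding operator_norm_def using False by (intro cSUP_upper) auto
  then show ?thesis using N0[OF False] by (simp add: divide_le_eq)
qed

section \<open>The fundamental matrix\<close>

lemma bounded_bilinear_matrix_mult:
  "bounded_bilinear (\<lambda>(A :: real ^ 'n ^ 'n) (B :: real ^ 'n ^ 'n). A ** B)"
  unfolding bilinear_conv_bounded_bilinear[symmetric] bilinear_def
  by (auto intro!: linearI simp: matrix_add_ldistrib matrix_matrix_mult_def vec_eq_iff
      sum.distrib algebra_simps sum_distrib_left)

lemma bounded_bilinear_matrix_vector_mult:
  "bounded_bilinear (\<lambda>(A :: real ^ 'n ^ 'n) (x :: real ^ 'n). A *v x)"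
  unfolding bilinear_conv_bounded_bilinear[symmetric] bilinear_def
  by (auto intro!: linearI simp: matrix_vector_mult_def vec_eq_iff
      sum.distrib algebra_simps sum_distrib_left)

lemma ts_from_ray:
  assumes "closed T" "\<not> bdd_above T" "s \<in> T"
  shows "ts_ray (ts_from T s) s"
proof
  show "closed (ts_from T s)" using assms(1) by (auto simp: ts_from_def)
  show "\<not> bdd_above (ts_from T s)"
  proof
    assume "bdd_above (ts_from T s)"
    then obtain B where "\<And>t. t \<in> T \<Longrightarrow> s \<le> t \<Longrightarrow> t \<le> B" unfolding bdd_above_def ts_from_def by auto
    then have "t \<le> max s B" if "t \<in> T" for t using that by fastforce
    then show False using assms(2) unfolding bdd_above_def by blast
  qed
qed (use assms in \<open>auto simp: ts_from_def\<close>)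

lemma sigma_ts_from: "s \<le> t \<Longrightarrow> sigma (ts_from T s) t = sigma T t"
  unfolding ts_from_def by (rule sigma_ray)

locale linear_system =
  fixes T :: "real set" and A :: "real \<Rightarrow> real ^ 'n ^ 'n" and M :: real
  assumes closed: "closed T" and unbounded: "\<not> bdd_above T"
    and A_bound: "\<And>t. t \<in> T \<Longrightarrow> norm (A t) \<le> M" and A_rd: "rd_continuous T A"
begin

abbreviation Phi :: "real \<Rightarrow> real \<Rightarrow> real ^ 'n ^ 'n" where
  "Phi t s \<equiv> fundamental_matrix T A t s"

lemma ray: "s \<in> T \<Longrightarrow> ts_ray (ts_from T s) s"
  by (rule ts_from_ray[OF closed unbounded])

lemma sub_ray_derivative:
  assumes "has_delta_derivative (ts_from T r) F t d" "r \<le> s" "s \<le> t"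
  shows "has_delta_derivative (ts_from T s) F t d"
  by (rule has_delta_derivative_subset[OF assms(1)])
    (use assms in \<open>auto simp: ts_from_def sigma_ray\<close>)

lemma Phi_exists:
  assumes s: "s \<in> T"
  shows "\<exists>Y. Y s = mat 1 \<and> (\<forall>t\<in>ts_from T s. has_delta_derivative (ts_from T s) Y t (A t ** Y t))
      \<and> (\<forall>t\<in>ts_from T s. Phi t s = Y t)"
proof -
  interpret R: ts_ray "ts_from T s" s by (rule ray[OF s])
  have bd: "\<And>t. t \<in> ts_from T s \<Longrightarrow> norm (A t) \<le> M" using A_bound by (simp add: ts_from_def)
  have "rd_continuous (ts_from T s) A"
    by (rule rd_continuous_subset[OF A_rd]) (auto simp: ts_from_def sigma_ray)
  from R.linear_ivp_exists[OF bounded_bilinear_matrix_mult this bd, of "mat 1"]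
  obtain Y where Y: "Y s = mat 1"
    "\<And>t. t \<in> ts_from T s \<Longrightarrow> has_delta_derivative (ts_from T s) Y t (A t ** Y t)" by blast
  have "Phi t s = Y t" if t: "t \<in> ts_from T s" for t
    unfolding fundamental_matrix_def
  proof (rule the_equality)
    show "\<exists>Z. Z s = mat 1 \<and> (\<forall>t\<in>ts_from T s. has_delta_derivative (ts_from T s) Z t (A t ** Z t)) \<and> Y t = Z t"
      using Y by blast
    fix B :: "real ^ 'n ^ 'n" assume "\<exists>Z. Z s = mat 1 \<and> (\<forall>t\<in>ts_from T s. has_delta_derivative (ts_from T s) Z t (A t ** Z t)) \<and> B = Z t"
    then obtain Z where Z: "Z s = mat 1"
      "\<And>t. t \<in> ts_from T s \<Longrightarrow> has_delta_derivative (ts_from T s) Z t (A t ** Z t)" "B = Z t" by blast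
    show "B = Y t"
      unfolding Z(3)
      by (rule R.linear_ivp_unique[OF bounded_bilinear_matrix_mult bd Z(2) Y(2) _ t]) (use Z(1) Y(1) in \<open>simp_all\<close>)

  qed
  then show ?thesis using Y by blast
qed

lemma Phi_refl: "s \<in> T \<Longrightarrow> Phi s s = mat 1"
  using Phi_exists[of s] by (auto simp: ts_from_def)

lemma Phi_derivative:
  assumes "s \<in> T" "t \<in> T" "s \<le> t"
  shows "has_delta_derivative (ts_from T s) (\<lambda>t. Phi t s) t (A t ** Phi t s)"
proof -
  obtain Y where Y: "\<forall>t\<in>ts_from T s. has_delta_derivative (ts_from T s) Y t (A t ** Y t)"
    "\<forall>t\<in>ts_from T s. Phi t s = Y t" using Phi_exists[OF assms(1)] by blast
  have t: "t \<in> ts_from T s" using assms by (simp add: ts_from_def)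
  then have "has_delta_derivative (ts_from T s) Y t (A t ** Phi t s)" using Y by simp
  then show ?thesis by (rule ts_ray.has_delta_derivative_cong[OF ray[OF assms(1)]]) (use Y in simp)
qed

text \<open>As functions of t, both sides solve the same linear equation on the ray from r with the
  same value at r.\<close>

lemma Phi_cocycle:
  assumes "s \<in> T" "r \<in> T" "t \<in> T" "s \<le> r" "r \<le> t"
  shows "Phi t s = Phi t r ** Phi r s"
proof (rule ts_ray.linear_ivp_unique[OF ray[OF assms(2)] bounded_bilinear_matrix_mult,
      where Y = "\<lambda>t. Phi t s" and Z = "\<lambda>t. Phi t r ** Phi r s"])
  interpret m: bounded_bilinear "\<lambda>(A :: real ^ 'n ^ 'n) (B :: real ^ 'n ^ 'n). A ** B"
    by (rule bounded_bilinear_matrix_mult)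
  show "\<And>t. t \<in> ts_from T r \<Longrightarrow> norm (A t) \<le> M" using A_bound by (simp add: ts_from_def)
  show "has_delta_derivative (ts_from T r) (\<lambda>t. Phi t s) t (A t ** Phi t s)" if "t \<in> ts_from T r" for t
    using that assms by (intro sub_ray_derivative[OF Phi_derivative]) (auto simp: ts_from_def)
  show "has_delta_derivative (ts_from T r) (\<lambda>t. Phi t r ** Phi r s) t (A t ** (Phi t r ** Phi r s))"
    if "t \<in> ts_from T r" for t
    using has_delta_derivative_linear[OF m.bounded_linear_left Phi_derivative[of r t], of "Phi r s"] that assms
    by (simp add: ts_from_def matrix_mul_assoc)
  show "Phi r s = Phi r r ** Phi r s" using assms by (simp add: Phi_refl)
  show "t \<in> ts_from T r" using assms by (simp add: ts_from_def)
qed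

lemma Phi_sigma:
  assumes "t \<in> T"
  shows "Phi (sigma T t) t = mat 1 + (sigma T t - t) *\<^sub>R A t"
  using ts_ray.delta_derivative_scattered[OF ray[OF assms] _ Phi_derivative[OF assms assms order_refl]] assms
  by (simp add: ts_from_def sigma_ray Phi_refl)

text \<open>Here the initial time varies while t is fixed, so the differential equation in t gives
  no direct continuity statement. Instead \<open>delta_growth\<close> on each ray from s bounds the
  deviation from the identity by a quantity that vanishes with t - s. This is what the induction
  needs at left-dense points.\<close>

lemma Phi_left_limit:
  assumes t: "t \<in> T"
  shows "((\<lambda>s. Phi t s) \<longlongrightarrow> mat 1) (at t within (T \<inter> {..<t}))"
proof -
  interpret m: bounded_bilinear "\<lambda>(A :: real ^ 'n ^ 'n) (B :: real ^ 'n ^ 'n). A ** B"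
    by (rule bounded_bilinear_matrix_mult)
  obtain L where L: "L > 0" "\<And>(A :: real ^ 'n ^ 'n) (B :: real ^ 'n ^ 'n). norm (A ** B) \<le> norm A * norm B * L"
    using m.pos_bounded by blast
  have M0: "M \<ge> 0" using A_bound[OF t] norm_ge_zero[of "A t"] by linarith
  define b where "b = M * L * norm (mat 1 :: real ^ 'n ^ 'n)"
  have b0: "b \<ge> 0" using M0 L(1) by (simp add: b_def)
  have est: "norm (Phi t s - mat 1) \<le> b * (t - s) * exp (M * L * (t - s))" if s: "s \<in> T" "s < t" for s
  proof -
    have "norm (Phi t s - mat 1) \<le> (norm (Phi s s - mat 1) + b * (t - s)) * exp (M * L * (t - s))"
    proof (rule ts_ray.delta_growth[OF ray[OF s(1)], where J = "ts_from T s" and F' = "\<lambda>t. A t ** Phi t s - 0"])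
      show "has_delta_derivative (ts_from T s) (\<lambda>t. Phi t s - mat 1) r (A r ** Phi r s - 0)"
        if "r \<in> ts_from T s" for r
        using that s by (intro has_delta_derivative_diff Phi_derivative has_delta_derivative_const) (auto simp: ts_from_def)
      fix r assume r: "r \<in> ts_from T s"
      have "norm (A r ** Phi r s) \<le> norm (A r) * norm (Phi r s) * L" by (rule L(2))
      also have "\<dots> \<le> M * (norm (Phi r s - mat 1) + norm (mat 1 :: real ^ 'n ^ 'n)) * L"
        using A_bound[of r] r M0 L(1) norm_triangle_ineq[of "Phi r s - mat 1" "mat 1"]
        by (intro mult_right_mono mult_mono) (auto simp: ts_from_def)
      finally show "norm (A r ** Phi r s - 0) \<le> M * L * norm (Phi r s - mat 1) + b"
        by (simp add: b_def algebra_simps)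
    qed (use s t M0 L(1) b0 in \<open>auto simp: ts_from_def\<close>)
    then show ?thesis using s by (simp add: Phi_refl)
  qed
  have "((\<lambda>s. b * (t - s) * exp (M * L * (t - s))) \<longlongrightarrow> b * (t - t) * exp (M * L * (t - t))) (at t within (T \<inter> {..<t}))"
    by (intro tendsto_intros)
  then have "((\<lambda>s. b * (t - s) * exp (M * L * (t - s))) \<longlongrightarrow> 0) (at t within (T \<inter> {..<t}))" by simp
  then have "((\<lambda>s. Phi t s - mat 1) \<longlongrightarrow> 0) (at t within (T \<inter> {..<t}))"
    by (rule Lim_null_comparison[rotated]) (use est in \<open>auto simp: eventually_at_filter\<close>)
  then show ?thesis by (simp add: LIM_zero_iff)
qed

end

section \<open>The cylinder transformation\<close>

lemma xi_le: "h \<ge> 0 \<Longrightarrow> 1 + h * z > 0 \<Longrightarrow> xi h z \<le> z"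
  using ln_add_one_self_le_self2[of "z * h"] by (auto simp: xi_def divide_le_eq mult.commute)

lemma exp_xi: "h \<ge> 0 \<Longrightarrow> 1 + h * z > 0 \<Longrightarrow> exp (h * xi h z) = 1 + h * z"
  by (auto simp: xi_def mult.commute)

text \<open>Since ln (1 + w) - w is of order w^2 with w = z h, division by h leaves an error of
  order z^2 h. The case h = 0 has no error, so the two branches of \<open>xi\<close> fit together in
  the limit.\<close>

lemma tendsto_xi:
  assumes "(h \<longlongrightarrow> 0) F" "(z \<longlongrightarrow> l) F"
  shows "((\<lambda>x. xi (h x) (z x)) \<longlongrightarrow> l) F"
proof -
  have "((\<lambda>x. z x * h x) \<longlongrightarrow> l * 0) F" by (intro tendsto_intros assms)
  then have "\<forall>\<^sub>F x in F. dist (z x * h x) 0 < 1 / 2" by (intro tendstoD) auto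
  then have ev: "\<forall>\<^sub>F x in F. norm (xi (h x) (z x) - z x) \<le> 2 * (z x)\<^sup>2 * \<bar>h x\<bar>"
  proof eventually_elim
    case (elim x)
    show ?case
    proof (cases "h x = 0")
      case False
      have "\<bar>ln (1 + z x * h x) - z x * h x\<bar> \<le> 2 * (z x * h x)\<^sup>2"
        using elim by (intro abs_ln_one_plus_x_minus_x_bound) auto
      moreover have "xi (h x) (z x) - z x = (ln (1 + z x * h x) - z x * h x) / h x"
        using False by (simp add: xi_def field_simps)
      ultimately have "norm (xi (h x) (z x) - z x) \<le> 2 * (z x * h x)\<^sup>2 / \<bar>h x\<bar>"
        by (simp add: divide_right_mono)
      also have "\<dots> = 2 * (z x)\<^sup>2 * \<bar>h x\<bar>"
        using False by (simp add: power_mult_distrib field_simps power2_eq_square)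
      finally show ?thesis .
    qed (simp add: xi_def)
  qed
  have "((\<lambda>x. 2 * (z x)\<^sup>2 * \<bar>h x\<bar>) \<longlongrightarrow> 2 * l\<^sup>2 * \<bar>0\<bar>) F" by (intro tendsto_intros assms)
  then have "((\<lambda>x. xi (h x) (z x) - z x) \<longlongrightarrow> 0) F"
    by (intro Lim_null_comparison[OF ev]) simp
  from tendsto_add[OF this assms(2)] show ?thesis by simp
qed

context ts_ray
begin

lemma mu_ge: "0 \<le> mu X t"
  using sigma_ge[of t] by (simp add: mu_def)

lemma mu_left_limit:
  assumes "t \<in> X"
  shows "(mu X \<longlongrightarrow> 0) (at t within (X \<inter> {..<t}))"
proof (rule Lim_null_comparison)
  show "\<forall>\<^sub>F s in at t within (X \<inter> {..<t}). norm (mu X s) \<le> t - s"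
    using sigma_le[OF assms] mu_ge by (auto simp: eventually_at_filter mu_def)
  have "((\<lambda>s. t - s) \<longlongrightarrow> t - t) (at t within (X \<inter> {..<t}))" by (intro tendsto_intros)
  then show "((\<lambda>s. t - s) \<longlongrightarrow> 0) (at t within (X \<inter> {..<t}))" by simp
qed

text \<open>No gap straddles a point of X: gaps starting before t end by t, and gaps starting
  between t and p end by p, a point of X within e of t.\<close>

lemma mu_right_dense_limit:
  assumes "t \<in> X" "sigma X t = t"
  shows "(mu X \<longlongrightarrow> 0) (at t within X)"
proof (rule tendstoI)
  fix e :: real assume e: "e > 0"
  obtain p where p: "p \<in> X" "t < p" "p < t + e" using right_dense_near[OF assms(2), of "t + e"] e by auto
  have "dist (mu X s) 0 < e" if s: "s \<in> X" "s \<noteq> t" "dist s t < min e (p - t)" for s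
  proof (cases "s < t")
    case True
    then show ?thesis using sigma_le[OF assms(1) True] s mu_ge[of s] by (auto simp: mu_def dist_real_def)
  next
    case False
    then have "s < p" using s by (auto simp: dist_real_def)
    then show ?thesis using sigma_le[OF p(1), of s] s p mu_ge[of s] False by (auto simp: mu_def dist_real_def)
  qed
  then show "\<forall>\<^sub>F s in at t within X. dist (mu X s) 0 < e"
    unfolding eventually_at using e p(2) by (intro exI[of _ "min e (p - t)"]) auto
qed

lemma rd_continuous_xi:
  assumes "rd_continuous X u"
  shows "rd_continuous X (\<lambda>t. xi (mu X t) (u t))"
  unfolding rd_continuous_def
proof (intro conjI ballI)
  fix t assume t: "t \<in> right_dense X"
  then have "(u \<longlongrightarrow> u t) (at t within X)" using assms unfolding rd_continuous_def by blast
  moreover have "(mu X \<longlongrightarrow> 0) (at t within X)" "mu X t = 0"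
    using mu_right_dense_limit t by (auto simp: right_dense_def mu_def)
  ultimately show "((\<lambda>t. xi (mu X t) (u t)) \<longlongrightarrow> xi (mu X t) (u t)) (at t within X)"
    using tendsto_xi by (auto simp: xi_def)
next
  fix t assume t: "t \<in> left_dense X"
  then obtain l where l: "(u \<longlongrightarrow> l) (at t within (X \<inter> {..<t}))" using assms unfolding rd_continuous_def by blast
  have "t \<in> X" using t by (simp add: left_dense_def)
  from tendsto_xi[OF mu_left_limit[OF this] l]
  show "\<exists>l. ((\<lambda>t. xi (mu X t) (u t)) \<longlongrightarrow> l) (at t within (X \<inter> {..<t}))" by blast
qed

end

section \<open>The perturbed system\<close>

text \<open>\<open>J\<close> may be the domain of a partial solution. The bound at
  \<open>sigma T t\<close> matters when J ends at a right-scattered point: the next value lies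
  beyond J, yet an escape by that jump must be excluded. The bound on \<open>f\<close> is required
  only where \<open>N y \<le> q\<close>, and \<open>K * v t \<le> q\<close> keeps the solution
  there.\<close>

lemma (in linear_system) perturbation_estimate:
  fixes N :: "real ^ 'n \<Rightarrow> real"
  defines "X \<equiv> ts_from T 0"
  assumes N: "vector_norm N" and zero: "0 \<in> T"
    and Phi_bound: "\<And>s t y. s \<in> X \<Longrightarrow> t \<in> X \<Longrightarrow> s \<le> t \<Longrightarrow> N (Phi t s *v y) \<le> C * exp (E t - E s) * N y"
    and C: "C > 0" and eps: "\<epsilon> > 0" and kap: "\<kappa> > 0" and K: "K > 0"
    and E_sigma: "\<And>t. t \<in> X \<Longrightarrow> exp (E (sigma T t) - E t) = 1 + mu T t * u t"
    and U_sigma: "\<And>t. t \<in> X \<Longrightarrow> U (sigma T t) = U t + mu T t * u t"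
    and E_le_U: "\<And>s t. s \<in> X \<Longrightarrow> t \<in> X \<Longrightarrow> s \<le> t \<Longrightarrow> E t - E s \<le> U t - U s"
    and U_cont: "\<And>t. t \<in> X \<Longrightarrow> (U \<longlongrightarrow> U t) (at t within X)"
    and v: "v = (\<lambda>t. exp (U t + (C * \<epsilon> + \<kappa>) * t))"
    and t0: "t0 \<in> X" and J: "J \<subseteq> ts_from T t0"
    and J_down: "\<And>s t. t \<in> J \<Longrightarrow> s \<in> ts_from T t0 \<Longrightarrow> s \<le> t \<Longrightarrow> s \<in> J"
    and sol: "\<And>t. t \<in> J \<Longrightarrow> has_delta_derivative (ts_from T t0) x t (A t *v x t + f t (x t))"
    and f: "\<And>t y. t \<in> X \<Longrightarrow> N y \<le> q \<Longrightarrow> N (f t y) \<le> \<epsilon> * N y"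
    and vq: "\<And>t. t \<in> X \<Longrightarrow> t0 \<le> t \<Longrightarrow> K * v t \<le> q"
    and start: "C * N (x t0) \<le> K * v t0" and tJ: "t \<in> J"
  shows "N (x t) \<le> K * v t \<and> N (x (sigma T t)) \<le> K * v (sigma T t)"
proof -
  have t0T: "t0 \<in> T" "0 \<le> t0" using t0 by (auto simp: X_def ts_from_def)
  interpret R: ts_ray "ts_from T t0" t0 by (rule ray[OF t0T(1)])
  interpret mv: bounded_bilinear "\<lambda>(A :: real ^ 'n ^ 'n) (x :: real ^ 'n). A *v x"
    by (rule bounded_bilinear_matrix_vector_mult)
  obtain k where k: "k > 0" "\<And>x. N x \<le> k * norm x" using vector_norm_upper[OF N] by blast
  note N_ge_0 = vector_norm_ge_0[OF N]
  have rX: "t \<in> X" if "t \<in> ts_from T t0" for t using that t0T by (auto simp: X_def ts_from_def)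
  have v_pos: "v t > 0" for t by (simp add: v)
  define D where "D = C * \<epsilon> + \<kappa>"
  have D: "D > 0" using C eps kap by (simp add: D_def add_pos_pos)
  have sig: "sigma (ts_from T t0) t = sigma T t" if "t \<in> ts_from T t0" for t
    using that by (intro sigma_ts_from) (simp add: ts_from_def)
  define P where "P = (\<lambda>t. \<forall>t'\<in>T. t \<le> t' \<longrightarrow> N (Phi t' t *v x t) \<le> K * v t * exp (E t' - E t))"
  have P_bound: "N (x t) \<le> K * v t" if "P t" "t \<in> ts_from T t0" for t
    using that Phi_refl[of t] unfolding P_def ts_from_def by fastforce
  have P_start: "P t0"
    unfolding P_def
  proof (intro ballI impI)
    fix t' assume t': "t' \<in> T" "t0 \<le> t'"
    have "N (Phi t' t0 *v x t0) \<le> C * exp (E t' - E t0) * N (x t0)"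
      using t' t0 t0T by (intro Phi_bound) (auto simp: X_def ts_from_def)
    also have "\<dots> = exp (E t' - E t0) * (C * N (x t0))" by simp
    also have "\<dots> \<le> exp (E t' - E t0) * (K * v t0)" using start by (intro mult_left_mono) auto
    finally show "N (Phi t' t0 *v x t0) \<le> K * v t0 * exp (E t' - E t0)" by (simp add: mult.commute)
  qed
  have f_bound: "N (f t (x t)) \<le> \<epsilon> * (K * v t)" if "P t" "t \<in> ts_from T t0" for t
  proof -
    have "N (x t) \<le> q" using P_bound[OF that] vq[OF rX[OF that(2)]] that(2) by (simp add: ts_from_def)
    then have "N (f t (x t)) \<le> \<epsilon> * N (x t)" using f rX that(2) by blast
    also have "\<dots> \<le> \<epsilon> * (K * v t)" using P_bound[OF that] eps by simp
    finally show ?thesis .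
  qed
  have P_scattered: "P (sigma T t)" if t: "t \<in> J" "P t" "t < sigma T t" for t
    unfolding P_def
  proof (intro ballI impI)
    let ?s = "sigma T t" and ?m = "mu T t"
    have tr: "t \<in> ts_from T t0" using t J by auto
    have sr: "?s \<in> ts_from T t0" using R.sigma_in[of t] sig[OF tr] by simp
    have m: "?m > 0" "?m = ?s - t" using t by (auto simp: mu_def)
    fix t' assume t': "t' \<in> T" "?s \<le> t'"
    have t'X: "t' \<in> X" using t' rX[OF sr] by (auto simp: X_def ts_from_def)
    have "x ?s = x t + ?m *\<^sub>R (A t *v x t + f t (x t))"
      using R.delta_derivative_scattered[OF tr sol[OF t(1)]] sig[OF tr] m by simp
    also have "\<dots> = (mat 1 + ?m *\<^sub>R A t) *v x t + ?m *\<^sub>R f t (x t)"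
      by (simp add: mv.add_left mv.scaleR_left scaleR_add_right)
    also have "mat 1 + ?m *\<^sub>R A t = Phi ?s t" using Phi_sigma[of t] tr by (simp add: ts_from_def m)
    finally have "Phi t' ?s *v x ?s = (Phi t' ?s ** Phi ?s t) *v x t + ?m *\<^sub>R (Phi t' ?s *v f t (x t))"
      by (simp add: mv.add_right mv.scaleR_right matrix_vector_mul_assoc)
    also have "Phi t' ?s ** Phi ?s t = Phi t' t"
      using tr sr t' t(3) by (intro Phi_cocycle[symmetric]) (auto simp: ts_from_def)
    finally have "N (Phi t' ?s *v x ?s) \<le> N (Phi t' t *v x t) + ?m * N (Phi t' ?s *v f t (x t))"
      using vector_norm_triangle[OF N] vector_norm_scaleR[OF N] m(1) by (metis abs_of_pos)
    also have "N (Phi t' t *v x t) \<le> K * v t * exp (E t' - E t)"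
      using t t' unfolding P_def by simp
    also have "N (Phi t' ?s *v f t (x t)) \<le> C * exp (E t' - E ?s) * N (f t (x t))"
      using t' t'X rX[OF sr] by (intro Phi_bound)
    also have "C * exp (E t' - E ?s) * N (f t (x t)) \<le> C * exp (E t' - E ?s) * (\<epsilon> * (K * v t))"
      using f_bound[OF t(2) tr] C by (intro mult_left_mono) auto
    finally have "N (Phi t' ?s *v x ?s)
        \<le> K * v t * exp (E t' - E t) + ?m * (C * exp (E t' - E ?s) * (\<epsilon> * (K * v t)))"
      using m(1) by simp
    \<comment> \<open>The flow over the gap is the exact factor 1 + mu u, while the perturbation
      enters only at \<open>?s\<close>. Both terms thus share exp (E t' - E ?s) without a division
      by 1 + mu u, which is positive but may be arbitrarily small.\<close>
    also have "exp (E t' - E t) = exp (E t' - E ?s) * (1 + ?m * u t)"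
      unfolding E_sigma[OF rX[OF tr], symmetric] by (simp flip: exp_add)
    also have "K * v t * (exp (E t' - E ?s) * (1 + ?m * u t)) + ?m * (C * exp (E t' - E ?s) * (\<epsilon> * (K * v t)))
        = K * v t * exp (E t' - E ?s) * (1 + (?m * u t + C * \<epsilon> * ?m))"
      by (simp add: algebra_simps)
    also have "\<dots> \<le> K * v t * exp (E t' - E ?s) * exp (?m * u t + D * ?m)"
    proof (rule mult_left_mono)
      have "?m * u t + C * \<epsilon> * ?m \<le> ?m * u t + D * ?m" using m kap by (simp add: D_def)
      then show "1 + (?m * u t + C * \<epsilon> * ?m) \<le> exp (?m * u t + D * ?m)"
        using exp_ge_add_one_self[of "?m * u t + D * ?m"] by linarith
    qed (use K v_pos[of t] in simp)
    also have "\<dots> = K * v ?s * exp (E t' - E ?s)"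
    proof -
      have "U ?s + D * ?s = (U t + D * t) + (?m * u t + D * ?m)"
        unfolding U_sigma[OF rX[OF tr]] using arg_cong[OF m(2), of "\<lambda>z. D * z"]
        by (simp add: algebra_simps)
      then have "v ?s = v t * exp (?m * u t + D * ?m)" by (simp add: v D_def flip: exp_add)
      then show ?thesis by simp
    qed
    finally show "N (Phi t' ?s *v x ?s) \<le> K * v ?s * exp (E t' - E ?s)" .
  qed
  have P_dense: "\<exists>\<delta>>0. \<forall>s\<in>ts_from T t0. t < s \<longrightarrow> s < t + \<delta> \<longrightarrow> P s"
    if t: "t \<in> J" "P t" "sigma T t = t" for t
  proof -
    have tr: "t \<in> ts_from T t0" using t J by auto
    have tT: "t \<in> T" "t0 \<le> t" using tr by (auto simp: ts_from_def)
    interpret Rt: ts_ray "ts_from T t" t by (rule ray[OF tT(1)])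
    have tt: "t \<in> ts_from T t" using tT by (simp add: ts_from_def)
    \<comment> \<open>Deviation from the linear flow restarted at t; it vanishes at t, and its
      derivative there is the perturbation alone.\<close>
    define d where "d = (\<lambda>s. x s - Phi s t *v x t)"
    have "has_delta_derivative (ts_from T t) d t ((A t *v x t + f t (x t)) - (A t ** Phi t t) *v x t)"
      unfolding d_def
      by (intro has_delta_derivative_diff sub_ray_derivative[OF sol[OF t(1)]]
          has_delta_derivative_linear[OF mv.bounded_linear_left] Phi_derivative tT order_refl)
    then have der: "has_delta_derivative (ts_from T t) d t (f t (x t))" using tT by (simp add: Phi_refl)
    have d0: "d t = 0" using tT by (simp add: d_def Phi_refl)
    \<comment> \<open>After conversion from the Euclidean norm to N (factor k) and transport by the
      linear flow (factor C), the derivative error uses up exactly half of \<kappa>.\<close>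
    define \<eta> where "\<eta> = \<kappa> / 2 * (K * v t) / (C * k)"
    have eta: "\<eta> > 0" using kap K v_pos[of t] C k(1) by (simp add: \<eta>_def)
    obtain \<delta>1 where \<delta>1: "\<delta>1 > 0"
      "\<And>s. s \<in> ts_from T t \<Longrightarrow> \<bar>s - t\<bar> < \<delta>1 \<Longrightarrow> norm (d s - d t - (s - t) *\<^sub>R f t (x t)) \<le> \<eta> * \<bar>s - t\<bar>"
      using Rt.delta_derivative_dense[OF der _ eta] t(3) sigma_ts_from[of t t T] by auto
    \<comment> \<open>The other half of \<kappa> pays for the factor exp (U s - U t) that multiplies
      the gain D (s - t) in v: it may fall below 1, but near t it exceeds (C \<epsilon> +
      \<kappa>/2) / D, which is less than 1.\<close>
    have "((\<lambda>s. exp (U s - U t)) \<longlongrightarrow> exp (U t - U t)) (at t within X)"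
      by (intro tendsto_intros U_cont rX tr)
    moreover have "exp (U t - U t) > (C * \<epsilon> + \<kappa> / 2) / D" using kap D by (simp add: D_def divide_less_eq)
    ultimately have "\<forall>\<^sub>F s in at t within X. exp (U s - U t) > (C * \<epsilon> + \<kappa> / 2) / D" by (rule order_tendstoD(1))
    then obtain \<delta>2 where \<delta>2: "\<delta>2 > 0"
      "\<And>s. s \<in> X \<Longrightarrow> s \<noteq> t \<Longrightarrow> dist s t < \<delta>2 \<Longrightarrow> exp (U s - U t) > (C * \<epsilon> + \<kappa> / 2) / D"
      unfolding eventually_at by blast
    have "P s" if s: "s \<in> ts_from T t0" "t < s" "s < t + min \<delta>1 \<delta>2" for s
      unfolding P_def
    proof (intro ballI impI)
      fix t' assume t': "t' \<in> T" "s \<le> t'"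
      have t'X: "t' \<in> X" using t' rX[OF s(1)] by (auto simp: X_def ts_from_def)
      let ?h = "s - t"
      have h: "?h > 0" using s by simp
      have "norm (d s - ?h *\<^sub>R f t (x t)) \<le> \<eta> * ?h" using \<delta>1(2)[of s] s d0 by (simp add: ts_from_def)
      then have "k * norm (d s - ?h *\<^sub>R f t (x t)) \<le> k * (\<eta> * ?h)" using k(1) by simp
      then have "N (d s - ?h *\<^sub>R f t (x t)) \<le> k * (\<eta> * ?h)" using k(2) order_trans by blast
      moreover have "N (?h *\<^sub>R f t (x t)) \<le> ?h * (\<epsilon> * (K * v t))"
        using f_bound[OF t(2) tr] h by (simp add: vector_norm_scaleR[OF N])
      ultimately have Nd: "N (d s) \<le> k * (\<eta> * ?h) + ?h * (\<epsilon> * (K * v t))"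
        using vector_norm_triangle[OF N, of "d s - ?h *\<^sub>R f t (x t)" "?h *\<^sub>R f t (x t)"] by simp
      have "Phi t' s *v x s = (Phi t' s ** Phi s t) *v x t + Phi t' s *v d s"
        by (simp add: d_def mv.diff_right matrix_vector_mul_assoc)
      also have "Phi t' s ** Phi s t = Phi t' t"
        using tT s t' by (intro Phi_cocycle[symmetric]) (auto simp: ts_from_def)
      finally have "N (Phi t' s *v x s) \<le> N (Phi t' t *v x t) + N (Phi t' s *v d s)"
        using vector_norm_triangle[OF N] by metis
      also have "N (Phi t' t *v x t) \<le> K * v t * exp (E t' - E t)"
        using t s t' unfolding P_def by simp
      also have "N (Phi t' s *v d s) \<le> C * exp (E t' - E s) * N (d s)"
        using t' t'X rX[OF s(1)] by (intro Phi_bound)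
      also have "C * exp (E t' - E s) * N (d s)
          \<le> C * exp (E t' - E s) * (k * (\<eta> * ?h) + ?h * (\<epsilon> * (K * v t)))"
        using Nd C by (intro mult_left_mono) auto
      also have "\<dots> = exp (E t' - E s) * (C * k * \<eta> * ?h + C * \<epsilon> * (K * v t) * ?h)" by (simp add: algebra_simps)
      also have "C * k * \<eta> = \<kappa> / 2 * (K * v t)" using C k(1) by (simp add: \<eta>_def)
      also have "exp (E t' - E t) = exp (E t' - E s) * exp (E s - E t)" by (simp flip: exp_add)
      finally have "N (Phi t' s *v x s) \<le> K * v t * exp (E t' - E s) * (exp (E s - E t) + (C * \<epsilon> + \<kappa> / 2) * ?h)"
        by (simp add: algebra_simps)
      also have "\<dots> \<le> K * v t * exp (E t' - E s) * exp (U s - U t + D * ?h)"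
      proof (rule mult_left_mono)
        have e1: "exp (E s - E t) \<le> exp (U s - U t)" using E_le_U[OF rX[OF tr] rX[OF s(1)]] s by simp
        have "(C * \<epsilon> + \<kappa> / 2) / D < exp (U s - U t)"
          using \<delta>2(2)[OF rX[OF s(1)]] s by (simp add: dist_real_def)
        then have e2: "(C * \<epsilon> + \<kappa> / 2) * ?h \<le> exp (U s - U t) * D * ?h"
          using D h by (intro mult_right_mono) (simp_all add: divide_less_eq)
        have "exp (U s - U t) + exp (U s - U t) * D * ?h = exp (U s - U t) * (1 + D * ?h)"
          by (simp add: distrib_left)
        also have "\<dots> \<le> exp (U s - U t) * exp (D * ?h)" by simp
        finally show "exp (E s - E t) + (C * \<epsilon> + \<kappa> / 2) * ?h \<le> exp (U s - U t + D * ?h)"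
          unfolding exp_add using e1 e2 by linarith
      qed (use K v_pos[of t] in simp)
      also have "\<dots> = K * v s * exp (E t' - E s)"
        by (simp add: v D_def algebra_simps flip: exp_add)
      finally show "N (Phi t' s *v x s) \<le> K * v s * exp (E t' - E s)" .
    qed
    then show ?thesis using \<delta>1(1) \<delta>2(1) by (intro exI[of _ "min \<delta>1 \<delta>2"]) auto
  qed
  have P_left: "P t" if t: "t \<in> J" "t islimpt (ts_from T t0 \<inter> {..<t})"
    "\<And>s. s \<in> ts_from T t0 \<Longrightarrow> s < t \<Longrightarrow> P s" for t
    unfolding P_def
  proof (intro ballI impI)
    have tr: "t \<in> ts_from T t0" using t J by auto
    have tT: "t \<in> T" "t0 \<le> t" using tr by (auto simp: ts_from_def)
    fix t' assume t': "t' \<in> T" "t \<le> t'"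
    have t'X: "t' \<in> X" using t' rX[OF tr] by (auto simp: X_def ts_from_def)
    let ?S = "ts_from T t0 \<inter> {..<t}" and ?c = "C * exp (E t' - E t)"
    \<comment> \<open>The remainder after carrying x from s to t by the linear flow. It tends to 0
      as s approaches t from the left, so the claim at earlier points passes to the limit.\<close>
    let ?r = "\<lambda>s. x t - Phi t s *v x s"
    have "(x \<longlongrightarrow> x t) (at t within ?S)"
      using R.delta_derivative_continuous[OF tr sol[OF t(1)]] by (rule tendsto_within_subset) auto
    moreover have "((\<lambda>s. Phi t s) \<longlongrightarrow> mat 1) (at t within ?S)"
      using Phi_left_limit[OF tT(1)] by (rule tendsto_within_subset) (auto simp: ts_from_def)
    ultimately have "(?r \<longlongrightarrow> x t - mat 1 *v x t) (at t within ?S)"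
      by (intro tendsto_diff tendsto_const mv.tendsto)
    then have "((\<lambda>s. N (?r s)) \<longlongrightarrow> N 0) (at t within ?S)" by (intro vector_norm_tendsto[OF N]) simp
    then have lim: "((\<lambda>s. K * v t * exp (E t' - E t) + ?c * N (?r s)) \<longlongrightarrow> K * v t * exp (E t' - E t) + ?c * N 0)
        (at t within ?S)" by (intro tendsto_intros)
    have "N (Phi t' t *v x t) \<le> K * v t * exp (E t' - E t) + ?c * N (?r s)" if s: "s \<in> ?S" for s
    proof -
      have sr: "s \<in> ts_from T t0" "s < t" using s by auto
      have "Phi t' t *v x t = (Phi t' t ** Phi t s) *v x s + Phi t' t *v ?r s"
        by (simp add: mv.diff_right matrix_vector_mul_assoc)
      also have "Phi t' t ** Phi t s = Phi t' s"
        using tT s t' by (intro Phi_cocycle[symmetric]) (auto simp: ts_from_def)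
      finally have "N (Phi t' t *v x t) \<le> N (Phi t' s *v x s) + N (Phi t' t *v ?r s)"
        using vector_norm_triangle[OF N] by metis
      also have "N (Phi t' t *v ?r s) \<le> ?c * N (?r s)"
        using t' t'X rX[OF tr] by (intro Phi_bound)
      also have "N (Phi t' s *v x s) \<le> K * v s * exp (E t' - E s)"
        using t(3)[OF sr] sr(2) t' unfolding P_def by simp
      also have "\<dots> = K * exp (U s + D * s + (E t' - E s))" by (simp add: v D_def flip: exp_add)
      \<comment> \<open>The function U s + D s - E s is nondecreasing in s, so the bound obtained at
        s is dominated by the one wanted at t.\<close>
      also have "\<dots> \<le> K * exp (U t + D * t + (E t' - E t))"
      proof -
        have "D * s \<le> D * t" using D sr by simp
        moreover have "E t - E s \<le> U t - U s" using E_le_U[OF rX[OF sr(1)] rX[OF tr]] sr by simp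
        ultimately show ?thesis using K by simp
      qed
      also have "\<dots> = K * v t * exp (E t' - E t)" by (simp add: v D_def flip: exp_add)
      finally show ?thesis by simp
    qed
    then have "N (Phi t' t *v x t) \<le> K * v t * exp (E t' - E t) + ?c * N 0"
      using t(2) by (intro tendsto_lowerbound[OF lim]) (auto simp: eventually_at_filter trivial_limit_within)
    then show "N (Phi t' t *v x t) \<le> K * v t * exp (E t' - E t)" by (simp add: vector_norm_zero[OF N])
  qed
  have "P t" if "t \<in> J" for t
  proof (rule R.ts_induct[where J = J and P = P, OF J J_down P_start _ _ P_left that])
    fix t assume t: "t \<in> J"
    then have s: "sigma (ts_from T t0) t = sigma T t" using J sig by blast
    show "P (sigma (ts_from T t0) t)" if "t < sigma (ts_from T t0) t" "P t"
      using P_scattered[OF t] that s by simp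
    show "\<exists>\<delta>>0. \<forall>s\<in>ts_from T t0. t < s \<longrightarrow> s < t + \<delta> \<longrightarrow> P s" if "sigma (ts_from T t0) t = t" "P t"
      using P_dense[OF t] that s by simp
  qed
  then have Pt: "P t" using tJ by blast
  have tr: "t \<in> ts_from T t0" using tJ J by auto
  have sr: "sigma T t \<in> ts_from T t0" using R.sigma_in[of t] sig[OF tr] by simp
  have "P (sigma T t)"
    using P_scattered[OF tJ Pt] Pt R.sigma_ge[of t] sig[OF tr] by (cases "t < sigma T t") auto
  then show ?thesis using P_bound[OF Pt tr] P_bound[OF _ sr] by blast
qed

theorem theorem4p4:
  fixes T :: "real set"
    and N :: "real ^ 'n \<Rightarrow> real"
    and A :: "real \<Rightarrow> real ^ 'n ^ 'n"
  assumes "time_scale T"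
    and "\<not> bdd_above (right_scattered T)"
    and "vector_norm N"
    and "bounded (A ` T)"
    and "rd_continuous T A"
    and "regressive T A"
    and "central_upper_exponent N T A < 0"
  shows "\<exists>\<epsilon>>0. \<forall>r>0. \<forall>f :: real \<Rightarrow> real ^ 'n \<Rightarrow> real ^ 'n.
           uniquely_solvable T r (\<lambda>t x. A t *v x + f t x) \<longrightarrow>
           (\<exists>r1. 0 < r1 \<and> r1 \<le> r \<and>
              (\<forall>t\<in>ts_from T 0. \<forall>x\<in>ball 0 r1. N (f t x) \<le> \<epsilon> * N x)) \<longrightarrow>
           zero_asymptotically_stable N T r (\<lambda>t x. A t *v x + f t x)"
proof -
  note N = \<open>vector_norm N\<close>
  have zeroT: "0 \<in> T" and cl: "closed T" using assms(1) by (auto simp: time_scale_def)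
  \<comment> \<open>\<open>time_scale T\<close> alone would allow T to be unbounded only below; the
    scattered points supply unboundedness above.\<close>
  have unb: "\<not> bdd_above T"
    using assms(2) bdd_above_mono[of T "right_scattered T"] by (auto simp: right_scattered_def)
  obtain M where M: "\<And>t. t \<in> T \<Longrightarrow> norm (A t) \<le> M" using assms(4) unfolding bounded_iff by auto
  interpret linear_system T A M
    by unfold_locales (use cl unb M assms(5) in auto)
  let ?X = "ts_from T 0" and ?F = "inf at_top (principal T)"
  interpret R: ts_ray ?X 0 by (rule ray[OF zeroT])
  have XT: "t \<in> ?X \<longleftrightarrow> t \<in> T \<and> 0 \<le> t" for t by (auto simp: ts_from_def)
  have muX: "mu ?X t = mu T t" "sigma ?X t = sigma T t" if "t \<in> ?X" for t
    using that sigma_ts_from[of 0 t T] by (auto simp: mu_def XT)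
  obtain u where upper: "upper_function N T A u"
    and "Limsup ?F (\<lambda>t. ereal (1 / t * delta_integral ?X u 0 t)) < 0"
    using assms(7) unfolding central_upper_exponent_def INF_less_iff by blast
  then obtain c where "Limsup ?F (\<lambda>t. ereal (1 / t * delta_integral ?X u 0 t)) < ereal c" and c: "c < 0"
    using ereal_dense2 by force
  then have limsup: "\<forall>\<^sub>F t in ?F. ereal (1 / t * delta_integral ?X u 0 t) < ereal c" by (intro Limsup_lessD)
  have urd: "rd_continuous ?X u" and u_pos: "\<And>t. t \<in> ?X \<Longrightarrow> 1 + mu T t * u t > 0"
    using upper unfolding upper_function_def by auto
  obtain C where C: "C > 0" "\<And>s t. t \<in> ?X \<Longrightarrow> s \<in> ?X \<Longrightarrow> s \<le> t \<Longrightarrow>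
      operator_norm N (Phi t s) \<le> C * gen_exp ?X u t s"
    using upper unfolding upper_function_def by blast

  \<comment> \<open>Antiderivatives of the upper function and of its cylinder transform\<close>
  let ?\<xi> = "\<lambda>t. xi (mu ?X t) (u t)"
  define U where "U = (\<lambda>t. integral {0..t} (\<lambda>\<theta>. u (R.rho \<theta>)))"
  define E where "E = (\<lambda>t. integral {0..t} (\<lambda>\<theta>. ?\<xi> (R.rho \<theta>)))"
  have xird: "rd_continuous ?X ?\<xi>" by (rule R.rd_continuous_xi[OF urd])
  have dU: "has_delta_derivative ?X U t (u t)" if "t \<in> ?X" for t
    unfolding U_def by (rule R.delta_derivative_integral[OF urd that])
  have dE: "has_delta_derivative ?X E t (?\<xi> t)" if "t \<in> ?X" for t
    unfolding E_def by (rule R.delta_derivative_integral[OF xird that])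
  have intU: "delta_integral ?X u 0 t = U t" if "t \<in> ?X" for t
    using R.delta_integral_eq[OF dU, of 0 t] that zeroT by (simp add: XT U_def)
  have genE: "gen_exp ?X u t s = exp (E t - E s)" if "s \<in> ?X" "t \<in> ?X" for s t
    unfolding gen_exp_def using R.delta_integral_eq[OF dE, of s t] that by simp
  have Phi_bound: "N (Phi t s *v y) \<le> C * exp (E t - E s) * N y" if "s \<in> ?X" "t \<in> ?X" "s \<le> t" for s t y
  proof -
    have "N (Phi t s *v y) \<le> operator_norm N (Phi t s) * N y" by (rule operator_norm_bound[OF N])
    also have "\<dots> \<le> C * exp (E t - E s) * N y"
      using C(2)[OF that(2,1,3)] genE[OF that(1,2)] vector_norm_ge_0[OF N] by (intro mult_right_mono) auto
    finally show ?thesis .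
  qed
  have E_sigma: "exp (E (sigma T t) - E t) = 1 + mu T t * u t" if "t \<in> ?X" for t
    using R.delta_derivative_scattered[OF that dE[OF that]] u_pos[OF that] R.mu_ge[of t] muX[OF that]
    by (simp add: mu_def[symmetric] exp_xi)
  have U_sigma: "U (sigma T t) = U t + mu T t * u t" if "t \<in> ?X" for t
    using R.delta_derivative_scattered[OF that dU[OF that]] muX[OF that] by (simp add: mu_def)
  have E_le_U: "E t - E s \<le> U t - U s" if "s \<in> ?X" "t \<in> ?X" "s \<le> t" for s t
  proof -
    have "E t - E s = integral {s..t} (\<lambda>\<theta>. ?\<xi> (R.rho \<theta>))"
      unfolding E_def using Henstock_Kurzweil_Integration.integral_combine[OF _ that(3) R.rd_continuous_integrable[OF xird], of 0] that
      by (simp add: XT algebra_simps)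
    also have "\<dots> \<le> integral {s..t} (\<lambda>\<theta>. u (R.rho \<theta>))"
      using u_pos[OF R.rho_in] muX[OF R.rho_in]
      by (intro integral_le R.rd_continuous_integrable[OF xird] R.rd_continuous_integrable[OF urd]
          xi_le R.mu_ge) auto
    also have "\<dots> = U t - U s"
      unfolding U_def using Henstock_Kurzweil_Integration.integral_combine[OF _ that(3) R.rd_continuous_integrable[OF urd], of 0] that
      by (simp add: XT algebra_simps)
    finally show ?thesis .
  qed
  have U_cont: "(U \<longlongrightarrow> U t) (at t within ?X)" if "t \<in> ?X" for t
    by (rule R.delta_derivative_continuous[OF that dU[OF that]])

  \<comment> \<open>The constants, and the decay and boundedness of the majorant v\<close>
  define \<epsilon> where "\<epsilon> = - c / (4 * C)"
  define \<kappa> where "\<kappa> = - c / 4"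
  have eps: "\<epsilon> > 0" and kap: "\<kappa> > 0" using c C(1) by (auto simp: \<epsilon>_def \<kappa>_def divide_neg_pos)
  \<comment> \<open>C \<epsilon> and \<kappa> each take a quarter of -c; of the rate c available to
    U, half is left for the decay of v.\<close>
  have D: "C * \<epsilon> + \<kappa> = - c / 2" using C(1) by (simp add: \<epsilon>_def \<kappa>_def)
  define v where "v = (\<lambda>t. exp (U t + (C * \<epsilon> + \<kappa>) * t))"
  have v_pos: "v t > 0" for t by (simp add: v_def)
  obtain t1 where t1: "t1 > 0" and mean: "\<And>t. t \<in> T \<Longrightarrow> t1 \<le> t \<Longrightarrow> 1 / t * delta_integral ?X u 0 t < c"
  proof -
    have "\<forall>\<^sub>F t in at_top. t \<in> T \<longrightarrow> 1 / t * delta_integral ?X u 0 t < c"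
      using limsup by (simp add: eventually_inf_principal)
    then obtain b where "\<And>t. b \<le> t \<Longrightarrow> t \<in> T \<longrightarrow> 1 / t * delta_integral ?X u 0 t < c"
      unfolding eventually_at_top_linorder by blast
    \<comment> \<open>The maximum with 1 makes t positive, so that the inequality for the mean can
      be multiplied by t.\<close>
    then show thesis by (intro that[of "max b 1"]) auto
  qed
  have v_late: "v t \<le> exp (c / 2 * t)" if "t \<in> T" "t1 \<le> t" for t
  proof -
    have "U t / t < c" using mean[OF that] intU[of t] that t1 by (simp add: XT)
    then have "U t < c * t" using that t1 by (simp add: divide_less_eq)
    then show ?thesis by (simp add: v_def D)
  qed
  have v_lim: "(v \<longlongrightarrow> 0) ?F"
  proof (rule Lim_null_comparison)
    show "\<forall>\<^sub>F t in ?F. norm (v t) \<le> exp (c / 2 * t)"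
      unfolding eventually_inf_principal eventually_at_top_linorder
      using v_late v_pos by (intro exI[of _ t1]) (auto simp: less_imp_le)
    have "filterlim (\<lambda>t. c / 2 * t) at_bot at_top"
      using c by (intro filterlim_tendsto_neg_mult_at_bot[OF tendsto_const _ filterlim_ident]) auto
    then have "((\<lambda>t. exp (c / 2 * t)) \<longlongrightarrow> 0) at_top" by (rule filterlim_compose[OF exp_at_bot])
    then show "((\<lambda>t. exp (c / 2 * t)) \<longlongrightarrow> 0) ?F" by (rule tendsto_mono[rotated]) simp
  qed
  obtain B where B: "B > 0" "\<And>t. t \<in> ?X \<Longrightarrow> v t \<le> B"
  proof -
    \<comment> \<open>U is an ordinary integral, hence v is continuous on a whole real interval and
      bounded there by compactness; after t1 the exponential bound gives v <= 1.\<close>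
    have "continuous_on {0..t1} v"
      unfolding v_def U_def
      by (intro continuous_intros indefinite_integral_continuous_1 R.rd_continuous_integrable[OF urd])
    then obtain B1 where B1: "\<And>t. t \<in> {0..t1} \<Longrightarrow> v t \<le> B1"
      using continuous_attains_sup[of "{0..t1}" v] t1 by fastforce
    have "v t \<le> max B1 1" if t: "t \<in> ?X" for t
    proof (cases "t \<le> t1")
      case True
      then show ?thesis using B1[of t] t by (simp add: XT)
    next
      case False
      then have "v t \<le> exp (c / 2 * t)" using v_late t by (simp add: XT)
      also have "\<dots> \<le> 1" using c t by (simp add: XT mult_nonpos_nonneg)
      finally show ?thesis by simp
    qed
    then show thesis by (intro that[of "max B1 1"]) auto
  qed
  obtain l where l: "l > 0" "\<And>x. norm x \<le> l * N x" using vector_norm_lower[OF N] by blast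

  \<comment> \<open>Existence for all times, stability and attraction\<close>
  show ?thesis
  proof (intro exI[of _ \<epsilon>] conjI allI impI eps)
    fix r :: real and f :: "real \<Rightarrow> real ^ 'n \<Rightarrow> real ^ 'n"
    assume r: "0 < r" and solv: "uniquely_solvable T r (\<lambda>t x. A t *v x + f t x)"
      and "\<exists>r1. 0 < r1 \<and> r1 \<le> r \<and> (\<forall>t\<in>?X. \<forall>x\<in>ball 0 r1. N (f t x) \<le> \<epsilon> * N x)"
    then obtain r1 where r1: "0 < r1" "r1 \<le> r" "\<And>t x. t \<in> ?X \<Longrightarrow> x \<in> ball 0 r1 \<Longrightarrow> N (f t x) \<le> \<epsilon> * N x"
      by blast
    let ?g = "\<lambda>t x. A t *v x + f t x"
    \<comment> \<open>N measures the solution but \<open>ball\<close> is Euclidean; l converts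
      between them. The factor 2 keeps the solution within r1/2, at a positive distance from the
      boundary of the ball of radius r.\<close>
    define q where "q = r1 / (2 * l)"
    have q: "q > 0" using r1 l by (simp add: q_def)
    have small: "norm y \<le> r1 / 2" if "N y \<le> q" for y
    proof -
      have "norm y \<le> l * q" using l(2)[of y] mult_left_mono[OF that, of l] l(1) by linarith
      then show ?thesis using l(1) by (simp add: q_def)
    qed
    \<comment> \<open>One statement for both conclusions, with K free: stability takes K small,
      while attraction takes the largest K that is allowed.\<close>
    have bound: "(\<exists>x. delta_solution T r ?g t0 x0 (ts_from T t0) x) \<and>
        (\<forall>x. delta_solution T r ?g t0 x0 (ts_from T t0) x \<longrightarrow> (\<forall>t\<in>ts_from T t0. N (x t) \<le> K * v t))"
      if t0: "t0 \<in> ?X" and K: "K > 0" "K * B \<le> q" and x0: "C * N x0 \<le> K * v t0" for t0 K x0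
    proof -
      have t0': "t0 \<in> T" "0 \<le> t0" using t0 by (auto simp: XT)
      have Kv: "K * v t \<le> q" if "t \<in> ?X" for t
        using mult_left_mono[OF B(2)[OF that], of K] K by linarith
      have est: "N (x t) \<le> K * v t \<and> N (x (sigma T t)) \<le> K * v (sigma T t)"
        if x: "delta_solution T r ?g t0 x0 J x"
          and J: "J \<subseteq> ts_from T t0" "\<And>s t. t \<in> J \<Longrightarrow> s \<in> ts_from T t0 \<Longrightarrow> s \<le> t \<Longrightarrow> s \<in> J" and t: "t \<in> J"
        for x J t
      proof (rule perturbation_estimate[OF N zeroT Phi_bound C(1) eps kap K(1) E_sigma U_sigma E_le_U U_cont
            v_def t0 J, where x = x and f = f and q = q])
        show "has_delta_derivative (ts_from T t0) x t (A t *v x t + f t (x t))" if "t \<in> J" for t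
          using x that unfolding delta_solution_def by blast
        show "N (f t y) \<le> \<epsilon> * N y" if "t \<in> ?X" "N y \<le> q" for t y
          using r1(3)[OF that(1), of y] small[OF that(2)] r1(1) by simp
        show "C * N (x t0) \<le> K * v t0" using x x0 unfolding delta_solution_def by simp
      qed (use Kv t in auto)
      have est_norm: "norm (x t) \<le> r1 / 2 \<and> norm (x (sigma T t)) \<le> r1 / 2"
        if x: "delta_solution T r ?g t0 x0 J x"
          and J: "J \<subseteq> ts_from T t0" "\<And>s t. t \<in> J \<Longrightarrow> s \<in> ts_from T t0 \<Longrightarrow> s \<le> t \<Longrightarrow> s \<in> J" and t: "t \<in> J"
        for x J t
      proof -
        have tX: "t \<in> ?X" using t J(1) t0' by (auto simp: ts_from_def)
        have sX: "sigma T t \<in> ?X" using R.sigma_in[of t] muX[OF tX] by simp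
        have "N (x t) \<le> K * v t \<and> N (x (sigma T t)) \<le> K * v (sigma T t)"
          by (rule est[OF x J(1) _ t]) (rule J(2))
        then have "N (x t) \<le> q" "N (x (sigma T t)) \<le> q"
          using Kv[OF tX] Kv[OF sX] by auto
        then show ?thesis using small by blast
      qed
      \<comment> \<open>The flow from t0 to t0 is the identity, so the bound on \<open>Phi\<close>
        at equal times shows that the smallness of C N x0 controls N x0 itself.\<close>
      have "N x0 \<le> C * N x0" using Phi_bound[OF t0 t0 order_refl, of x0] Phi_refl[OF t0'(1)] by simp
      then have "norm x0 \<le> r1 / 2" using x0 Kv[OF t0] by (intro small) linarith
      then have "x0 \<in> ball 0 r" using r1 by simp
      then consider "\<exists>x. delta_solution T r ?g t0 x0 (ts_from T t0) x"
        | b x where "delta_solution T r ?g t0 x0 (T \<inter> {t0..<b}) x"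
          "(\<exists>t\<in>T \<inter> {t0..<b}. x (sigma T t) \<notin> ball 0 r) \<or> (\<forall>\<rho><r. \<exists>t\<in>T \<inter> {t0..<b}. \<rho> < norm (x t))"
        using solv t0 unfolding uniquely_solvable_def by blast
      then have "\<exists>x. delta_solution T r ?g t0 x0 (ts_from T t0) x"
      proof cases
        case (2 b x)
        \<comment> \<open>This refutes both ways of leaving the ball: a jump by the bound at
          \<open>sigma T t\<close>, and an approach to the boundary by the choice \<rho> =
          r1/2.\<close>
        have "norm (x t) \<le> r1 / 2 \<and> norm (x (sigma T t)) \<le> r1 / 2" if "t \<in> T \<inter> {t0..<b}" for t
          by (rule est_norm[OF 2(1) _ _ that]) (auto simp: ts_from_def)
        moreover have "r1 / 2 < r" using r1 by simp
        ultimately show ?thesis using 2(2) by fastforce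
      qed
      moreover have "\<forall>x. delta_solution T r ?g t0 x0 (ts_from T t0) x \<longrightarrow> (\<forall>t\<in>ts_from T t0. N (x t) \<le> K * v t)"
        using est[where J = "ts_from T t0"] by blast
      ultimately show ?thesis by blast
    qed
    show "zero_asymptotically_stable N T r ?g"
      unfolding zero_asymptotically_stable_def zero_stable_def
    proof (intro conjI ballI allI impI)
      fix t0 e :: real assume t0: "t0 \<in> ?X" and e: "e > 0"
      \<comment> \<open>With v <= B the solution stays below min q (e/2): the first entry keeps the
        bound on f valid, and the half in the second gives the strict inequality.\<close>
      define K where "K = min q (e / 2) / B"
      have K: "K > 0" "K * B \<le> q" "K * B < e" using q e B(1) by (auto simp: K_def min_def)
      have *: "(\<exists>x. delta_solution T r ?g t0 x0 (ts_from T t0) x) \<and>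
          (\<forall>x. delta_solution T r ?g t0 x0 (ts_from T t0) x \<longrightarrow> (\<forall>t\<in>ts_from T t0. N (x t) < e))"
        if "N x0 < K * v t0 / C" for x0
      proof -
        have "C * N x0 \<le> K * v t0" using that C(1) by (simp add: field_simps)
        note b = bound[OF t0 K(1,2) this]
        have "K * v t < e" if "t \<in> ts_from T t0" for t
        proof -
          have "t \<in> ?X" using that t0 by (auto simp: ts_from_def)
          then show ?thesis using mult_left_mono[OF B(2), of t K] K by linarith
        qed
        then show ?thesis using b by (meson le_less_trans)
      qed
      show "\<exists>\<delta>>0. \<forall>x0. N x0 < \<delta> \<longrightarrow> (\<exists>x. delta_solution T r ?g t0 x0 (ts_from T t0) x) \<and>
          (\<forall>x. delta_solution T r ?g t0 x0 (ts_from T t0) x \<longrightarrow> (\<forall>t\<in>ts_from T t0. N (x t) < e))"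
        using * K(1) v_pos[of t0] C(1) by (intro exI[of _ "K * v t0 / C"]) auto
    next
      fix t0 :: real assume t0: "t0 \<in> ?X"
      \<comment> \<open>No further smallness is required here, because convergence comes from v
        tending to 0.\<close>
      define K where "K = q / B"
      have K: "K > 0" "K * B \<le> q" using q B(1) by (auto simp: K_def)
      have *: "(\<exists>x. delta_solution T r ?g t0 x0 (ts_from T t0) x) \<and>
          (\<forall>x. delta_solution T r ?g t0 x0 (ts_from T t0) x \<longrightarrow> (x \<longlongrightarrow> 0) ?F)"
        if "N x0 < K * v t0 / C" for x0
      proof -
        have "C * N x0 \<le> K * v t0" using that C(1) by (simp add: field_simps)
        note b = bound[OF t0 K this]
        have "(x \<longlongrightarrow> 0) ?F" if "delta_solution T r ?g t0 x0 (ts_from T t0) x" for x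
        proof (rule Lim_null_comparison)
          show "\<forall>\<^sub>F t in ?F. norm (x t) \<le> l * K * v t"
            unfolding eventually_inf_principal eventually_at_top_linorder
          proof (intro exI[of _ t0] allI impI)
            fix t assume "t0 \<le> t" "t \<in> T"
            then have "N (x t) \<le> K * v t" using b that by (simp add: ts_from_def)
            then have "l * N (x t) \<le> l * (K * v t)" using l(1) by simp
            then show "norm (x t) \<le> l * K * v t" using l(2)[of "x t"] by simp
          qed
          show "((\<lambda>t. l * K * v t) \<longlongrightarrow> 0) ?F" by (rule tendsto_mult_right_zero[OF v_lim])
        qed
        then show ?thesis using b by blast
      qed
      show "\<exists>c>0. \<forall>x0. N x0 < c \<longrightarrow> (\<exists>x. delta_solution T r ?g t0 x0 (ts_from T t0) x) \<and>
          (\<forall>x. delta_solution T r ?g t0 x0 (ts_from T t0) x \<longrightarrow> (x \<longlongrightarrow> 0) ?F)"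
        using * K(1) v_pos[of t0] C(1) by (intro exI[of _ "K * v t0 / C"]) auto
    qed
  qed
qed

end
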